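(* Let $R$ be a consistent triple set and for $A,B\subseteq L_R$ put $\mathcal R_{A,B}=\{ab|c : a,b\in A,\ c\in B \text{ or } a,b\in B,\ c\in A\}$. Then $$\mathrm{cl}(R)=\bigcup_{\{A,B\}\in \mathfrak{L}^*(R;R)}\mathcal R_{A,B}.$$ Moreover, for any distinct $\{A,B\},\{A',B'\}\in\mathfrak{L}^*(R;R)$ we have $\mathcal R_{A,B}\cap\mathcal R_{A',B'}=\emptyset$. In particular, $\sum_{\{A,B\}\in\mathfrak{L}^*(R;R)}|\mathcal R_{A,B}|\le |L_R|^3$.
   Context: A rooted tree $T$ has a distinguished inner vertex (root); leaves are degree-1 vertices; inner vertices other than the root have degree at least 3. A triple $ab|c$ is the rooted binary tree on leaves $a,b,c$ where the path from $a$ to $b$ avoids the path from $c$ to the root; $ab|c=ba|c$. A rooted tree displays $ab|c$ if $a,b,c$ are leaves and the path from $a$ to $b$ does not intersect the path from $c$ to the root; $\mathcal R(T)$ is the set of displayed triples. A triple set is consistent if some rooted tree displays all its triples. $L_R$ is the set of leaves appearing in $R$. $\mathrm{cl}(R)=\bigcap\mathcal R(T)$ over all rooted trees $T$ with leaf set $L_R$ displaying $R$. For $\mathcal L\subseteq L_R$, the Ahograph $[R,\mathcal L]$ is the graph with vertex set $\mathcal L$ in which distinct $x,y\in\mathcal L$ are adjacent iff there is a triple $xy|z\in R$ with $z\in\mathcal L$; connected components are identified with their vertex sets. For a triple $ab|c$ with $a,b,c\in L_R$, $\mathfrak L(ab|c;R)$ is the set of all unordered pairs $\{A,B\}$ with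 $A,B\subseteq L_R$ such that $[R,A\cup B]$ has exactly two connected components, namely $A$ and $B$, one containing $a$ and $b$ and the other containing $c$. For $ab|c\in\mathrm{cl}(R)$ this set is nonempty and has a unique element $\{A^*,B^*\}$ maximizing $|A^*\cup B^*|$; it is denoted $\mathfrak L^*(ab|c;R)$. For $R'\subseteq\mathrm{cl}(R)$, $\mathfrak L^*(R';R)=\{\mathfrak L^*(r;R): r\in R'\}$. *)

theory Defs
  imports Main
begin

section \<open>Graphs and rooted trees\<close>

record 'v ugraph =
  verts :: "'v set"
  edges :: "'v set set"

record 'v rooted_graph = "'v ugraph" +
  root :: 'v

definition simple_graph :: "('v, 'z) ugraph_scheme \<Rightarrow> bool" where
  "simple_graph G \<longleftrightarrow>
     finite (verts G) \<and>
     (\<forall>e\<in>edges G. \<exists>u v. u \<in> verts G \<and> v \<in> verts G \<and> u \<noteq> v \<and> e = {u, v})"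

definition adj :: "('v, 'z) ugraph_scheme \<Rightarrow> ('v \<times> 'v) set" where
  "adj G = {(u, v). {u, v} \<in> edges G}"

definition degree :: "('v, 'z) ugraph_scheme \<Rightarrow> 'v \<Rightarrow> nat" where
  "degree G v = card {e \<in> edges G. v \<in> e}"

definition components :: "('v, 'z) ugraph_scheme \<Rightarrow> 'v set set" where
  "components G = (\<lambda>x. {y. (x, y) \<in> (adj G)\<^sup>*}) ` verts G"

definition connected_graph :: "('v, 'z) ugraph_scheme \<Rightarrow> bool" where
  "connected_graph G \<longleftrightarrow>
     verts G \<noteq> {} \<and> (\<forall>x\<in>verts G. \<forall>y\<in>verts G. (x, y) \<in> (adj G)\<^sup>*)"

definition is_path :: "('v, 'z) ugraph_scheme \<Rightarrow> 'v \<Rightarrow> 'v list \<Rightarrow> 'v \<Rightarrow> bool" where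
  "is_path G x p y \<longleftrightarrow>
     p \<noteq> [] \<and> hd p = x \<and> last p = y \<and> distinct p \<and> set p \<subseteq> verts G \<and>
     successively (\<lambda>u v. {u, v} \<in> edges G) p"

definition is_cycle :: "('v, 'z) ugraph_scheme \<Rightarrow> 'v list \<Rightarrow> bool" where
  "is_cycle G p \<longleftrightarrow>
     3 \<le> length p \<and> distinct p \<and> set p \<subseteq> verts G \<and>
     successively (\<lambda>u v. {u, v} \<in> edges G) p \<and> {last p, hd p} \<in> edges G"

definition is_tree :: "('v, 'z) ugraph_scheme \<Rightarrow> bool" where
  "is_tree G \<longleftrightarrow> simple_graph G \<and> connected_graph G \<and> (\<nexists>p. is_cycle G p)"

text \<open>In a tree the path between two vertices is unique.\<close>

definition the_path :: "('v, 'z) ugraph_scheme \<Rightarrow> 'v \<Rightarrow> 'v \<Rightarrow> 'v list" where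
  "the_path G x y = (THE p. is_path G x p y)"

definition leaves :: "('v, 'z) ugraph_scheme \<Rightarrow> 'v set" where
  "leaves G = {v \<in> verts G. degree G v = 1}"

text \<open>An inner vertex is a vertex that is not a leaf. The one-vertex tree, whose root has degree 0,
  is therefore a rooted tree; its leaf set is empty, as needed for the empty triple set.\<close>

definition rooted_tree :: "'v rooted_graph \<Rightarrow> bool" where
  "rooted_tree T \<longleftrightarrow>
     is_tree T \<and>
     root T \<in> verts T - leaves T \<and>
     (\<forall>v \<in> verts T - leaves T. v \<noteq> root T \<longrightarrow> 3 \<le> degree T v)"

section \<open>Triples\<close>

text \<open>The triple $ab|c = ba|c$ is encoded as the pair of the set $\{a,b\}$ and $c$.\<close>

type_synonym 'a triple = "'a set \<times> 'a"

abbreviation triple :: "'a \<Rightarrow> 'a \<Rightarrow> 'a \<Rightarrow> 'a triple" where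
  "triple a b c \<equiv> ({a, b}, c)"

definition is_triple :: "'a triple \<Rightarrow> bool" where
  "is_triple t \<longleftrightarrow> (\<exists>a b c. distinct [a, b, c] \<and> t = triple a b c)"

definition triple_set :: "'a triple set \<Rightarrow> bool" where
  "triple_set R \<longleftrightarrow> (\<forall>t\<in>R. is_triple t)"

definition leaf_set :: "'a triple set \<Rightarrow> 'a set" where
  "leaf_set R = (\<Union>(ab, c)\<in>R. insert c ab)"

definition displayed :: "'v rooted_graph \<Rightarrow> 'v triple set" where
  "displayed T =
     {triple a b c | a b c.
        distinct [a, b, c] \<and> a \<in> leaves T \<and> b \<in> leaves T \<and> c \<in> leaves T \<and>
        set (the_path T a b) \<inter> set (the_path T c (root T)) = {}}"

text \<open>Triples live on an arbitrary type \<open>'a\<close>, which may be too small to also provide the inner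
  vertices of a tree. Trees for triples on \<open>'a\<close> therefore have vertices in \<open>'a + nat\<close>, where
  \<open>x :: 'a\<close> is identified with \<open>Inl x\<close>. As trees are finite, every rooted tree with leaves in \<open>'a\<close>
  is isomorphic, by an isomorphism that fixes the leaves, to one of this kind.\<close>

definition emb :: "'a triple \<Rightarrow> ('a + nat) triple" where
  "emb = map_prod ((`) Inl) Inl"

definition consistent :: "'a triple set \<Rightarrow> bool" where
  "consistent R \<longleftrightarrow>
     (\<exists>T :: ('a + nat) rooted_graph. rooted_tree T \<and> emb ` R \<subseteq> displayed T)"

definition cl :: "'a triple set \<Rightarrow> 'a triple set" where
  "cl R = (\<Inter>T \<in> {T :: ('a + nat) rooted_graph.
              rooted_tree T \<and> leaves T = Inl ` leaf_set R \<and> emb ` R \<subseteq> displayed T}.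
            {t. emb t \<in> displayed T})"

section \<open>Ahographs and the sets L and L*\<close>

definition ahograph :: "'a triple set \<Rightarrow> 'a set \<Rightarrow> 'a ugraph" where
  "ahograph R L =
     \<lparr>verts = L,
      edges = {{x, y} | x y. x \<in> L \<and> y \<in> L \<and> x \<noteq> y \<and> (\<exists>z\<in>L. triple x y z \<in> R)}\<rparr>"

text \<open>Unordered pairs $\{A,B\}$ are two-element sets of sets. Since they are unordered, \<open>A\<close> may be
  taken to be the component containing $a$ and $b$.\<close>

definition Lsets :: "'a triple \<Rightarrow> 'a triple set \<Rightarrow> 'a set set set" where
  "Lsets t R =
     {{A, B} | A B.
        A \<subseteq> leaf_set R \<and> B \<subseteq> leaf_set R \<and> A \<noteq> B \<and>
        components (ahograph R (A \<union> B)) = {A, B} \<and>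
        fst t \<subseteq> A \<and> snd t \<in> B}"

text \<open>For \<open>t \<in> cl R\<close> with \<open>R\<close> consistent, the maximizer exists and is unique.\<close>

definition Lstar :: "'a triple \<Rightarrow> 'a triple set \<Rightarrow> 'a set set" where
  "Lstar t R = (THE P. is_arg_max (\<lambda>P. card (\<Union>P)) (\<lambda>P. P \<in> Lsets t R) P)"

definition Lstar_set :: "'a triple set \<Rightarrow> 'a triple set \<Rightarrow> 'a set set set" where
  "Lstar_set R' R = (\<lambda>t. Lstar t R) ` R'"

definition triples_between :: "'a set \<Rightarrow> 'a set \<Rightarrow> 'a triple set" where
  "triples_between A B =
     {triple a b c | a b c.
        distinct [a, b, c] \<and> (a \<in> A \<and> b \<in> A \<and> c \<in> B \<or> a \<in> B \<and> b \<in> B \<and> c \<in> A)}"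

text \<open>\<open>triples_between\<close> as a function of the unordered pair, see \<open>triples_of_pair_eq\<close>.\<close>

definition triples_of_pair :: "'a set set \<Rightarrow> 'a triple set" where
  "triples_of_pair P = \<Union>{triples_between A B | A B. P = {A, B}}"

lemma triples_between_commute: "triples_between A B = triples_between B A"
  unfolding triples_between_def by blast

lemma triples_of_pair_eq: "triples_of_pair {A, B} = triples_between A B"
  unfolding triples_of_pair_def
  by (auto simp: doubleton_eq_iff triples_between_commute[of B A])

text \<open>A consistent set is finite, so the cardinalities and the sum of the theorem are genuine.\<close>

lemma consistent_finite:
  assumes "consistent R"
  shows "finite R"
proof -
  obtain T :: "('a + nat) rooted_graph" where T: "rooted_tree T" "emb ` R \<subseteq> displayed T"
    using assms unfolding consistent_def by blast
  have "finite (verts T)"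
    using T(1) by (simp add: rooted_tree_def is_tree_def simple_graph_def)
  moreover have "displayed T \<subseteq> Pow (verts T) \<times> verts T"
    by (auto simp: displayed_def leaves_def)
  ultimately have "finite (displayed T)"
    by (meson finite_Pow_iff finite_SigmaI finite_subset)
  hence "finite (emb ` R)"
    using T(2) finite_subset by blast
  moreover have "inj_on emb R"
    unfolding emb_def by (auto simp: inj_on_def map_prod_def inj_image_eq_iff)
  ultimately show ?thesis
    using finite_imageD by blast
qed

end

(* A rooted tree is, up to isomorphism, the laminar family of the leaf sets below its vertices, and it
   displays ab|c iff some cluster contains a and b but not c. In terms of such families: if [R, A \<union> B]
   has the two components A and B, every tree displaying R separates A from B, so R_{A,B} is contained
   in cl(R); conversely, if no such pair separates ab from c, then trees can be glued along the
   components of Ahographs to a tree that displays R but not ab|c. Pairs that separate ab from c are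
   closed under (A \<union> A', B \<union> B'), which yields a greatest pair L*(ab|c), and every triple in R_{A,B}
   with {A,B} = L*(t) has again the greatest pair {A,B}. Hence the sets R_{A,B} are disjoint. As
   [R, A] is disconnected by consistency, some edge inside A comes from a triple of R in R_{A,B}, so
   L*(R;R) already contains all greatest pairs. *)

theory Submission
  imports Defs
begin

section \<open>Paths in trees\<close>

text \<open>The recurring tool is that consistency disconnects every Ahograph on at least two
  vertices. In a laminar family displaying R, call a cluster small for S if it does not contain S.
  An edge xy of [R, S] comes from some xy|z with z in S, so x and y share a small cluster. Sharing
  one is transitive by laminarity, yet the small clusters through x form a chain whose largest
  member misses some element of S. This is why pairs can be joined: overlapping old components leave
  at most two components in the graph on the union, hence exactly two. It is also why the gluing can
  recurse: if a, b and c lie in one component of [R, S], that component is a proper subset of S. The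
  format of trees is the other obstacle. A tree is built from a family enlarged by its leaf set and
  all singletons; the leaf set may be empty but must not have exactly one element, because the root
  is not allowed to be a leaf.\<close>

lemma is_path_singleton: "is_path G x [z] y \<longleftrightarrow> x = z \<and> y = z \<and> z \<in> verts G"
  by (auto simp: is_path_def)

lemma is_path_Cons_Cons:
  "is_path G x (z # w # p) y \<longleftrightarrow>
     z = x \<and> x \<in> verts G \<and> x \<notin> set (w # p) \<and> {x, w} \<in> edges G \<and> is_path G w (w # p) y"
  by (auto simp: is_path_def)

lemma is_path_suffix: "is_path G x (us @ u # vs) y \<Longrightarrow> is_path G u (u # vs) y"
  by (auto simp: is_path_def successively_append_iff)

lemma is_path_endpoints: "is_path G x p y \<Longrightarrow> x \<in> set p \<and> y \<in> set p"
  by (auto simp: is_path_def)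

lemma is_path_Cons:
  assumes "is_path G w p y" "x \<in> verts G" "x \<notin> set p" "{x, w} \<in> edges G"
  shows "is_path G x (x # p) y"
  using assms by (cases p) (auto simp: is_path_def)

lemma is_path_ConsE:
  assumes "is_path G x p y" "x \<noteq> y"
  obtains w q where "p = x # q" "{x, w} \<in> edges G" "is_path G w q y" "x \<notin> set q"
proof (cases p)
  case Nil
  then show ?thesis using assms by (simp add: is_path_def)
next
  case (Cons z q)
  note p = this
  show ?thesis
  proof (cases q)
    case Nil
    then show ?thesis using assms p by (simp add: is_path_singleton)
  next
    case (Cons w r)
    then show ?thesis using assms p that[of q w] by (simp add: is_path_Cons_Cons)
  qed
qed

text \<open>If the new vertex x already lies on the path, the part from x onwards is taken.
  \<open>W\<close> is kept throughout so that a walk avoiding a vertex or a root path yields a path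
  that avoids it too.\<close>

lemma rtrancl_imp_path:
  assumes "(x, y) \<in> (adj G \<inter> W \<times> W)\<^sup>*" "x \<in> W" "W \<subseteq> verts G"
  shows "\<exists>p. is_path G x p y \<and> set p \<subseteq> W"
  using assms(1,2)
proof (induction rule: converse_rtrancl_induct)
  case base
  then show ?case using assms(3) by (intro exI[of _ "[y]"]) (auto simp: is_path_singleton)
next
  case (step x z)
  then obtain p where p: "is_path G z p y" "set p \<subseteq> W" by blast
  show ?case
  proof (cases "x \<in> set p")
    case True
    then obtain us vs where "p = us @ x # vs" by (meson split_list)
    then show ?thesis using p is_path_suffix[of G z us x vs y] by (intro exI[of _ "x # vs"]) auto
  next
    case False
    then have "is_path G x (x # p) y"
      using step p assms(3) by (intro is_path_Cons[OF p(1)]) (auto simp: adj_def)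
    then show ?thesis using p step by fastforce
  qed
qed

lemma path_imp_rtrancl:
  "is_path G x p y \<Longrightarrow> set p \<subseteq> W \<Longrightarrow> (x, y) \<in> (adj G \<inter> W \<times> W)\<^sup>*"
proof (induction p arbitrary: x)
  case Nil
  then show ?case by (simp add: is_path_def)
next
  case (Cons z q)
  show ?case
  proof (cases "x = y")
    case False
    then obtain w where w: "{x, w} \<in> edges G" "is_path G w q y"
      using is_path_ConsE[OF Cons.prems(1) False] by (metis list.inject)
    have "(x, w) \<in> adj G \<inter> W \<times> W"
      using w Cons.prems is_path_endpoints[OF w(2)] is_path_endpoints[OF Cons.prems(1)]
      by (auto simp: adj_def)
    then show ?thesis using Cons.IH[OF w(2)] Cons.prems by (auto intro: converse_rtrancl_into_rtrancl)
  qed simp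
qed

lemma sym_adj: "sym (adj G)"
  by (auto simp: sym_def adj_def insert_commute)

lemma rtrancl_sym: "sym r \<Longrightarrow> (x, y) \<in> r\<^sup>* \<Longrightarrow> (y, x) \<in> r\<^sup>*"
  by (meson sym_rtrancl symD)

lemma sym_adj_restrict: "sym (adj G \<inter> W \<times> W)"
  using sym_adj[of G] by (auto simp: sym_def)

text \<open>If the second vertices u and w differ, the two tails connect them through y without
  meeting x. A path from u to w off x then closes up to a cycle through x.\<close>

lemma path_unique:
  assumes acyclic: "\<nexists>p. is_cycle G p"
  shows "is_path G x p y \<Longrightarrow> is_path G x q y \<Longrightarrow> p = q"
proof (induction p arbitrary: x q)
  case Nil
  then show ?case by (simp add: is_path_def)
next
  case (Cons z p)
  show ?case
  proof (cases "x = y")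
    case True
    have "r = [x]" if "is_path G x r x" for r
    proof (cases r)
      case Nil
      then show ?thesis using that by (simp add: is_path_def)
    next
      case (Cons a list)
      then show ?thesis using that by (auto simp: is_path_def split: if_splits)
    qed
    from this[of "z # p"] this[of q] show ?thesis using Cons.prems True by simp
  next
    case False
    obtain u where u: "z = x" "{x, u} \<in> edges G" "is_path G u p y" "x \<notin> set p"
      using is_path_ConsE[OF Cons.prems(1) False] by (metis list.inject)
    obtain w q' where w: "q = x # q'" "{x, w} \<in> edges G" "is_path G w q' y" "x \<notin> set q'"
      using is_path_ConsE[OF Cons.prems(2) False] by metis
    have "u = w"
    proof (rule ccontr)
      assume "u \<noteq> w"
      define W where "W = verts G - {x}"
      have *: "set p \<subseteq> W" "set q' \<subseteq> W" using u w by (auto simp: W_def is_path_def)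
      have "(u, y) \<in> (adj G \<inter> W \<times> W)\<^sup>*" "(y, w) \<in> (adj G \<inter> W \<times> W)\<^sup>*"
        using path_imp_rtrancl[OF u(3) *(1)] path_imp_rtrancl[OF w(3) *(2)]
        by (auto intro: rtrancl_sym[OF sym_adj_restrict])
      then have "(u, w) \<in> (adj G \<inter> W \<times> W)\<^sup>*" by simp
      moreover have "u \<in> W" using is_path_endpoints[OF u(3)] * by auto
      ultimately obtain r where r: "is_path G u r w" "set r \<subseteq> W"
        using rtrancl_imp_path[of u w G W] by (auto simp: W_def)
      have "length r \<ge> 2"
        using r(1) \<open>u \<noteq> w\<close> by (cases r rule: remdups_adj.cases) (auto simp: is_path_def)
      moreover have "x \<in> verts G" using Cons.prems(2) by (auto simp: is_path_def)
      ultimately have "is_cycle G (x # r)"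
        using r u w unfolding is_cycle_def is_path_def W_def
        by (auto simp: successively_Cons insert_commute)
      then show False using acyclic by blast
    qed
    then show ?thesis using Cons.IH[OF u(3)] w u by blast
  qed
qed

lemma adj_simple_graph: "simple_graph G \<Longrightarrow> adj G \<subseteq> verts G \<times> verts G"
proof clarify
  fix u v
  assume "simple_graph G" "(u, v) \<in> adj G"
  then obtain a b where "a \<in> verts G" "b \<in> verts G" "{u, v} = {a, b}"
    unfolding simple_graph_def adj_def by blast
  then show "u \<in> verts G \<and> v \<in> verts G" by (auto simp: doubleton_eq_iff)
qed

lemma the_path_eq: "is_tree G \<Longrightarrow> is_path G x p y \<Longrightarrow> the_path G x y = p"
  unfolding the_path_def is_tree_def by (metis (no_types, lifting) path_unique the_equality)

lemma is_path_the_path: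
  assumes "is_tree G" "x \<in> verts G" "y \<in> verts G"
  shows "is_path G x (the_path G x y) y"
proof -
  have "adj G \<inter> verts G \<times> verts G = adj G"
    using adj_simple_graph[of G] assms(1) by (auto simp: is_tree_def)
  moreover have "(x, y) \<in> (adj G)\<^sup>*" using assms by (simp add: is_tree_def connected_graph_def)
  ultimately obtain p where "is_path G x p y"
    using rtrancl_imp_path[of x y G "verts G"] assms(2) by auto
  then show ?thesis using the_path_eq[OF assms(1)] by metis
qed

section \<open>Ancestors\<close>

definition anc :: "'v rooted_graph \<Rightarrow> 'v \<Rightarrow> 'v set" where
  "anc T v = set (the_path T v (root T))"

context
  fixes T :: "'v rooted_graph"
  assumes tree: "is_tree T" and root: "root T \<in> verts T"
begin

lemma anc_subset_verts: "v \<in> verts T \<Longrightarrow> anc T v \<subseteq> verts T"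
  using is_path_the_path[OF tree _ root] by (auto simp: anc_def is_path_def)

lemma anc_refl: "v \<in> verts T \<Longrightarrow> v \<in> anc T v"
  using is_path_the_path[OF tree _ root] is_path_endpoints by (metis anc_def)

lemma anc_path: "is_path T v p (root T) \<Longrightarrow> anc T v = set p"
  by (simp add: anc_def the_path_eq[OF tree])

lemma anc_mono: 
  assumes "v \<in> verts T" "u \<in> anc T v"
  shows "anc T u \<subseteq> anc T v"
proof -
  obtain us vs where "the_path T v (root T) = us @ u # vs"
    using assms by (metis anc_def split_list)
  then show ?thesis
    using is_path_suffix is_path_the_path[OF tree assms(1) root] anc_path unfolding anc_def
    by (metis Un_iff set_append subsetI)
qed

lemma anc_chain:
  assumes "v \<in> verts T" "u \<in> anc T v" "w \<in> anc T v"
  shows "u \<in> anc T w \<or> w \<in> anc T u"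
proof -
  obtain us vs where p: "the_path T v (root T) = us @ u # vs"
    using assms by (metis anc_def split_list)
  have path: "is_path T v (us @ u # vs) (root T)"
    using is_path_the_path[OF tree assms(1) root] p by simp
  have "anc T u = set (u # vs)" using is_path_suffix[OF path] by (rule anc_path)
  moreover have "u \<in> anc T w" if "w \<in> set us"
  proof -
    obtain us1 us2 where "us = us1 @ w # us2" using \<open>w \<in> set us\<close> by (meson split_list)
    then have "is_path T w (w # us2 @ u # vs) (root T)" using path is_path_suffix by force
    then show ?thesis by (simp add: anc_path)
  qed
  moreover have "w \<in> set us \<union> set (u # vs)" using assms(3) p by (auto simp: anc_def)
  ultimately show ?thesis by auto
qed

text \<open>If v is off the root path of u, prepending v gives the root path of v. Otherwise,
  prepending u to the part from v onwards is again a path to the root, hence by uniqueness the root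
  path of u. So one end of an edge is the parent of the other.\<close>

lemma anc_edge:
  assumes e: "{u, v} \<in> edges T"
  shows "anc T u = insert u (anc T v) \<or> anc T v = insert v (anc T u)"
proof -
  have uv: "u \<in> verts T" "v \<in> verts T" "u \<noteq> v"
    using e tree by (fastforce simp: is_tree_def simple_graph_def doubleton_eq_iff)+
  note pu = is_path_the_path[OF tree uv(1) root]
  note pv = is_path_the_path[OF tree uv(2) root]
  show ?thesis
  proof (cases "v \<in> anc T u")
    case False
    then have "is_path T v (v # the_path T u (root T)) (root T)"
      using is_path_Cons[OF pu uv(2)] e by (auto simp: anc_def insert_commute)
    then show ?thesis by (simp add: anc_path) (simp add: anc_def)
  next
    case True
    then obtain us vs where p: "the_path T u (root T) = us @ v # vs"
      by (metis anc_def split_list)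
    have v: "is_path T v (v # vs) (root T)" using pu p is_path_suffix by metis
    have "us \<noteq> []" using pu p uv(3) by (auto simp: is_path_def)
    then have "u \<notin> set (v # vs)" using pu p by (cases us) (auto simp: is_path_def)
    then have "is_path T u (u # v # vs) (root T)" using is_path_Cons[OF v uv(1)] e by auto
    then show ?thesis using v by (simp add: anc_path)
  qed
qed

lemma rtrancl_up:
  assumes "x \<in> verts T" "w \<in> anc T x" 
  shows "(x, w) \<in> (adj T \<inter> {u. w \<in> anc T u} \<times> {u. w \<in> anc T u})\<^sup>*"
proof -
  note px = is_path_the_path[OF tree assms(1) root]
  obtain us vs where p: "the_path T x (root T) = us @ w # vs"
    using assms by (metis anc_def split_list)
  have path: "is_path T x (us @ w # vs) (root T)" using px p by simp
  then have "is_path T x (us @ [w]) w" by (auto simp: is_path_def successively_append_iff hd_append)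
  moreover have "w \<in> anc T u" if "u \<in> set (us @ [w])" for u
  proof (cases "u = w")
    case True
    then show ?thesis using assms anc_refl anc_subset_verts by blast
  next
    case False
    then have "u \<in> set us" using that by simp
    then obtain us1 us2 where "us = us1 @ u # us2" by (meson split_list)
    then have "is_path T u (u # us2 @ w # vs) (root T)" using path is_path_suffix by force
    then show ?thesis by (simp add: anc_path)
  qed
  ultimately show ?thesis by (intro path_imp_rtrancl) auto
qed

text \<open>The right-hand side, that some common ancestor w of x and y is not above z, is the form
  that clusters can express. Given such a w, both x and y climb to w inside the subtree of w, and
  this subtree does not meet \<open>anc T z\<close>.\<close>

lemma path_avoids_anc_iff:
  assumes xyz: "x \<in> verts T" "y \<in> verts T" "z \<in> verts T"
  shows "set (the_path T x y) \<inter> anc T z = {} \<longleftrightarrow> \<not> anc T x \<inter> anc T y \<subseteq> anc T z"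
proof
  define W where "W = verts T - anc T z"
  assume "set (the_path T x y) \<inter> anc T z = {}"
  then have "set (the_path T x y) \<subseteq> W"
    using is_path_the_path[OF tree xyz(1,2)] by (auto simp: W_def is_path_def)
  then have xy: "(x, y) \<in> (adj T \<inter> W \<times> W)\<^sup>*" "x \<in> W"
    using path_imp_rtrancl[OF is_path_the_path[OF tree xyz(1,2)]]
      is_path_endpoints[OF is_path_the_path[OF tree xyz(1,2)]] by auto
  \<comment> \<open>The witness is carried back along the path, edge by edge. It changes only when
    it is the child end u of the edge; then the parent x takes over, which is above y through u and
    outside \<open>anc T z\<close> because x is in \<open>W\<close>.\<close>
  from xy have "\<exists>w \<in> anc T x \<inter> anc T y. w \<notin> anc T z"
  proof (induction rule: converse_rtrancl_induct)
    case base
    then show ?case using anc_refl by (auto simp: W_def)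
  next
    case (step x u)
    then obtain w where w: "w \<in> anc T u" "w \<in> anc T y" "w \<notin> anc T z" by auto
    consider "anc T x = insert x (anc T u)" | "anc T u = insert u (anc T x)" 
      using anc_edge[of x u] step.hyps by (auto simp: adj_def)
    then show ?case
    proof cases
      case 1
      then show ?thesis using w by blast
    next
      case 2
      show ?thesis
      proof (cases "w = u")
        case True
        have "x \<in> anc T x" "x \<notin> anc T z" using step.prems anc_refl by (auto simp: W_def)
        moreover have "x \<in> anc T y" using anc_mono[OF xyz(2) w(2)] 2 True calculation(1) by blast
        ultimately show ?thesis by blast
      qed (use 2 w in blast)
    qed
  qed
  then show "\<not> anc T x \<inter> anc T y \<subseteq> anc T z" by blast
next
  assume "\<not> anc T x \<inter> anc T y \<subseteq> anc T z"
  then obtain w where w: "w \<in> anc T x" "w \<in> anc T y" "w \<notin> anc T z" by blast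
  define W where "W = verts T - anc T z"
  have "adj T \<inter> {u. w \<in> anc T u} \<times> {u. w \<in> anc T u} \<subseteq> adj T \<inter> W \<times> W"
    using adj_simple_graph[of T] tree anc_mono[OF xyz(3)] w(3)
    by (auto simp: W_def is_tree_def)
  from rtrancl_mono[OF this] have "(x, w) \<in> (adj T \<inter> W \<times> W)\<^sup>*" "(y, w) \<in> (adj T \<inter> W \<times> W)\<^sup>*"
    using rtrancl_up xyz w by blast+
  then have "(x, y) \<in> (adj T \<inter> W \<times> W)\<^sup>*"
    by (rule rtrancl_trans[OF _ rtrancl_sym[OF sym_adj_restrict]])
  moreover have "x \<in> W" using anc_mono[OF xyz(3)] w xyz(1) by (auto simp: W_def)
  ultimately obtain p where "is_path T x p y" "set p \<subseteq> W"
    using rtrancl_imp_path[of x y T W] by (auto simp: W_def)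
  then show "set (the_path T x y) \<inter> anc T z = {}"
    using the_path_eq[OF tree] by (auto simp: W_def)
qed

end


section \<open>Rooted trees as laminar families\<close>

definition laminar :: "'a set set \<Rightarrow> bool" where
  "laminar F \<longleftrightarrow> (\<forall>C\<in>F. \<forall>D\<in>F. C \<inter> D = {} \<or> C \<subseteq> D \<or> D \<subseteq> C)"

text \<open>With \<open>F = UNIV\<close> these are all triples on \<open>X\<close>, so intersecting
  R with \<open>cluster_triples X UNIV\<close> restricts R to \<open>X\<close>.\<close>

definition cluster_triples :: "'a set \<Rightarrow> 'a set set \<Rightarrow> 'a triple set" where
  "cluster_triples X F = {triple a b c | a b c. distinct [a, b, c] \<and> {a, b, c} \<subseteq> X \<and>
     (\<exists>C\<in>F. a \<in> C \<and> b \<in> C \<and> c \<notin> C)}"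

lemma triple_eq_iff: "triple a b c = triple x y z \<longleftrightarrow> (a = x \<and> b = y \<or> a = y \<and> b = x) \<and> c = z"
  by (auto simp: doubleton_eq_iff)

lemma triple_in_cluster_triples:
  "triple a b c \<in> cluster_triples X F \<longleftrightarrow>
     distinct [a, b, c] \<and> {a, b, c} \<subseteq> X \<and> (\<exists>C\<in>F. a \<in> C \<and> b \<in> C \<and> c \<notin> C)"
  unfolding cluster_triples_def mem_Collect_eq triple_eq_iff by auto

lemma cluster_triplesE:
  assumes "t \<in> cluster_triples X F"
  obtains a b c where "t = triple a b c" "distinct [a, b, c]" "{a, b, c} \<subseteq> X"
  using assms unfolding cluster_triples_def by blast

lemma laminar_restrict:
  assumes "laminar F"
  obtains G where "laminar G" "G \<subseteq> Pow X" "cluster_triples X G = cluster_triples X F"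
proof
  show "laminar ((\<lambda>C. C \<inter> X) ` F)" using assms unfolding laminar_def by blast
  show "cluster_triples X ((\<lambda>C. C \<inter> X) ` F) = cluster_triples X F"
    unfolding cluster_triples_def by (intro Collect_cong ex_cong1 conj_cong refl) auto
qed auto

section \<open>Clusters of a rooted tree\<close>

lemma triple_in_displayed:
  assumes "rooted_tree T"
  shows "triple a b c \<in> displayed T \<longleftrightarrow> distinct [a, b, c] \<and> {a, b, c} \<subseteq> leaves T \<and>
     \<not> anc T a \<inter> anc T b \<subseteq> anc T c"
proof -
  have T: "is_tree T" "root T \<in> verts T" using assms by (auto simp: rooted_tree_def)
  have "leaves T \<subseteq> verts T" by (auto simp: leaves_def)
  then have iff: "set (the_path T x y) \<inter> set (the_path T z (root T)) = {} \<longleftrightarrow>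
      \<not> anc T x \<inter> anc T y \<subseteq> anc T z"
    if "{x, y, z} \<subseteq> leaves T" for x y z
    using path_avoids_anc_iff[OF T, of x y z] that by (auto simp: anc_def[of T z])
  show ?thesis
  proof
    assume "triple a b c \<in> displayed T"
    then obtain x y where xy: "a = x \<and> b = y \<or> a = y \<and> b = x" "distinct [x, y, c]"
        "{x, y, c} \<subseteq> leaves T" "set (the_path T x y) \<inter> set (the_path T c (root T)) = {}"
      unfolding displayed_def mem_Collect_eq triple_eq_iff by auto
    then have "\<not> anc T x \<inter> anc T y \<subseteq> anc T c" using iff by blast
    then show "distinct [a, b, c] \<and> {a, b, c} \<subseteq> leaves T \<and> \<not> anc T a \<inter> anc T b \<subseteq> anc T c"
      using xy by (auto simp: Int_commute)
  next
    assume "distinct [a, b, c] \<and> {a, b, c} \<subseteq> leaves T \<and> \<not> anc T a \<inter> anc T b \<subseteq> anc T c"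
    then show "triple a b c \<in> displayed T" using iff[of a b c] unfolding displayed_def by blast
  qed
qed

lemma emb_triple: "emb (triple a b c) = triple (Inl a) (Inl b) (Inl c)"
  by (simp add: emb_def)

lemma emb_eq_tripleE:
  fixes t :: "'a triple"
  assumes "emb t = triple x y z"
  obtains a b c where "t = triple a b c" "x = Inl a" "y = Inl b" "z = Inl c"
proof -
  obtain s c where t: "t = (s, c)" by (cases t)
  then have s: "Inl ` s = {x, y}" and z: "z = Inl c" using assms by (auto simp: emb_def)
  obtain a b where ab: "a \<in> s" "b \<in> s" "x = Inl a" "y = Inl b" using s by blast
  then have "(Inl ` s :: ('a + nat) set) = Inl ` {a, b}" using s by simp
  then have "s = {a, b}" using inj_image_eq_iff[OF inj_Inl] by blast
  then show ?thesis using that t z ab by blast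
qed

lemma emb_in_displayed:
  fixes T :: "('a + nat) rooted_graph"
  assumes "rooted_tree T"
  shows "emb t \<in> displayed T \<longleftrightarrow>
    (\<exists>a b c. t = triple a b c \<and> distinct [a, b, c] \<and> {Inl a, Inl b, Inl c} \<subseteq> leaves T \<and>
      \<not> anc T (Inl a) \<inter> anc T (Inl b) \<subseteq> anc T (Inl c))"
proof
  assume t: "emb t \<in> displayed T"
  then obtain x y z where "emb t = triple x y z" by (auto simp: displayed_def)
  then obtain a b c where "t = triple a b c" by (metis emb_eq_tripleE)
  then show "\<exists>a b c. t = triple a b c \<and> distinct [a, b, c] \<and> {Inl a, Inl b, Inl c} \<subseteq> leaves T \<and>
      \<not> anc T (Inl a) \<inter> anc T (Inl b) \<subseteq> anc T (Inl c)"
    using t unfolding \<open>t = _\<close> emb_triple triple_in_displayed[OF assms] by auto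
next
  assume "\<exists>a b c. t = triple a b c \<and> distinct [a, b, c] \<and> {Inl a, Inl b, Inl c} \<subseteq> leaves T \<and>
      \<not> anc T (Inl a) \<inter> anc T (Inl b) \<subseteq> anc T (Inl c)"
  then obtain a b c where "t = triple a b c" "distinct [a, b, c]" "{Inl a, Inl b, Inl c} \<subseteq> leaves T"
      "\<not> anc T (Inl a) \<inter> anc T (Inl b) \<subseteq> anc T (Inl c)" by blast
  then show "emb t \<in> displayed T"
    by (simp add: emb_triple triple_in_displayed[OF assms])
qed

text \<open>If \<open>desc u\<close> and \<open>desc w\<close> share a leaf z, then u and w lie on
  the root path of z and are comparable, so the two clusters are nested. A tree witnessing
  consistency may have leaves of the form \<open>Inr n\<close>; the clusters ignore them.\<close>

lemma rooted_tree_laminar: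
  fixes T :: "('a + nat) rooted_graph"
  assumes T: "rooted_tree T"
  obtains F where "laminar F"
    "\<And>t. emb t \<in> displayed T \<longleftrightarrow> t \<in> cluster_triples {x. Inl x \<in> leaves T} F"
proof
  define desc where "desc w = {x. Inl x \<in> leaves T \<and> w \<in> anc T (Inl x)}" for w
  have tree: "is_tree T" "root T \<in> verts T" using T by (auto simp: rooted_tree_def)
  have leaf: "leaves T \<subseteq> verts T" by (auto simp: leaves_def)
  have "desc u \<inter> desc w = {} \<or> desc u \<subseteq> desc w \<or> desc w \<subseteq> desc u" for u w
  proof (rule disjCI)
    assume "\<not> (desc u \<subseteq> desc w \<or> desc w \<subseteq> desc u)"
    then obtain x y where x: "x \<in> desc u" "x \<notin> desc w" and y: "y \<in> desc w" "y \<notin> desc u" by blast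
    show "desc u \<inter> desc w = {}"
    proof (rule ccontr)
      assume "desc u \<inter> desc w \<noteq> {}"
      then obtain z where z: "Inl z \<in> verts T" "u \<in> anc T (Inl z)" "w \<in> anc T (Inl z)"
        using leaf by (auto simp: desc_def)
      have "u \<in> anc T w \<or> w \<in> anc T u" using anc_chain[OF tree] z by blast
      moreover have "u \<notin> anc T w"
        using y leaf anc_mono[OF tree, of "Inl y" w] by (auto simp: desc_def)
      moreover have "w \<notin> anc T u"
        using x leaf anc_mono[OF tree, of "Inl x" u] by (auto simp: desc_def)
      ultimately show False by blast
    qed
  qed
  then show "laminar (range desc)" unfolding laminar_def by blast
  have "(\<exists>C\<in>range desc. a \<in> C \<and> b \<in> C \<and> c \<notin> C) \<longleftrightarrow>
      \<not> anc T (Inl a) \<inter> anc T (Inl b) \<subseteq> anc T (Inl c)"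
    if "{Inl a, Inl b, Inl c} \<subseteq> leaves T" for a b c
    using that by (auto simp: desc_def)
  then show "emb t \<in> displayed T \<longleftrightarrow> t \<in> cluster_triples {x. Inl x \<in> leaves T} (range desc)" for t
    unfolding emb_in_displayed[OF T] cluster_triples_def by (simp cong: conj_cong)
qed

section \<open>From laminar families back to trees\<close>

lemma cycle_two_neighbours:
  assumes "is_cycle G p" "u \<in> set p"
  shows "\<exists>v\<in>set p. \<exists>w\<in>set p. v \<noteq> w \<and> {u, v} \<in> edges G \<and> {u, w} \<in> edges G"
proof -
  obtain us vs where p: "p = us @ u # vs" using assms(2) by (meson split_list)
  have c: "3 \<le> length p" "distinct p" "successively (\<lambda>u v. {u, v} \<in> edges G) p"
    "{last p, hd p} \<in> edges G" using assms(1) by (auto simp: is_cycle_def)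
  \<comment> \<open>The closing edge joins the two ends of the list, so it supplies one of the
    neighbours when u is an end.\<close>
  consider "us = []" "2 \<le> length vs" | "vs = []" "2 \<le> length us" | "us \<noteq> []" "vs \<noteq> []"
    using c(1) p by fastforce
  then show ?thesis
  proof cases
    case 1
    then have "hd vs \<noteq> last vs" using c(2) p by (cases vs) auto
    moreover have "vs \<noteq> []" using 1 by auto
    moreover from this have "{u, hd vs} \<in> edges G" "{u, last vs} \<in> edges G"
      using 1 c p by (auto simp: successively_Cons insert_commute)
    ultimately show ?thesis using p by (metis Un_iff hd_in_set last_in_set list.set_intros(2) set_append)
  next
    case 2
    then have "hd us \<noteq> last us" using c(2) p by (cases us) auto
    moreover have "us \<noteq> []" using 2 by auto
    moreover from this have "{u, hd us} \<in> edges G" "{u, last us} \<in> edges G"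
      using 2 c p by (auto simp: successively_append_iff insert_commute)
    ultimately show ?thesis using p by (metis Un_iff hd_in_set last_in_set set_append)
  next
    case 3
    then have "last us \<noteq> hd vs" using c(2) p by (metis IntI UnCI distinct_append empty_iff hd_in_set last_in_set list.set_intros(2))
    moreover have "{u, last us} \<in> edges G" "{u, hd vs} \<in> edges G"
      using 3 c p by (auto simp: successively_append_iff successively_Cons insert_commute)
    ultimately show ?thesis using 3 p by (metis Un_iff hd_in_set last_in_set list.set_intros(2) set_append)
  qed
qed

text \<open>Since \<open>h\<close> increases strictly towards r, following \<open>par\<close>
  reaches r. On a cycle, a vertex of least height would have two distinct neighbours that both equal
  its parent. \<open>A\<close> lets the caller prescribe the root paths by their recursion.\<close>

lemma parent_tree:
  fixes par :: "'v \<Rightarrow> 'v" and h :: "'v \<Rightarrow> nat"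
  assumes fin: "finite V" and r: "r \<in> V"
    and par: "\<And>v. v \<in> V \<Longrightarrow> v \<noteq> r \<Longrightarrow> par v \<in> V \<and> h v < h (par v)"
    and A_root: "A r = {r}" and A_par: "\<And>v. v \<in> V \<Longrightarrow> v \<noteq> r \<Longrightarrow> A v = insert v (A (par v))"
    and T: "T = \<lparr>verts = V, edges = {{v, par v} | v. v \<in> V \<and> v \<noteq> r}, root = r\<rparr>"
  shows "is_tree T" and "\<And>v. v \<in> V \<Longrightarrow> anc T v = A v"
proof -
  have sel: "verts T = V" "edges T = {{v, par v} | v. v \<in> V \<and> v \<noteq> r}" "root T = r" by (simp_all add: T)
  have bound: "h v \<le> Max (h ` V)" if "v \<in> V" for v using fin that by simp
  have path: "\<exists>p. is_path T v p r \<and> set p = A v \<and> (\<forall>u\<in>set p. h v \<le> h u)" if "v \<in> V" for v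
    using that
  proof (induction "Max (h ` V) - h v" arbitrary: v rule: less_induct)
    case less
    show ?case
    proof (cases "v = r")
      case True
      then show ?thesis using less.prems A_root by (intro exI[of _ "[r]"]) (simp add: sel is_path_singleton)
    next
      case False
      have v: "par v \<in> V" "h v < h (par v)" using par less.prems False by auto
      then have "Max (h ` V) - h (par v) < Max (h ` V) - h v" using bound[OF v(1)] by linarith
      then obtain p where p: "is_path T (par v) p r" "set p = A (par v)" "\<forall>u\<in>set p. h (par v) \<le> h u"
        using less.hyps v(1) by blast
      moreover have "v \<notin> set p" using p(3) v(2) by fastforce
      moreover have "{v, par v} \<in> edges T" using less.prems False by (auto simp: sel)
      ultimately have "is_path T v (v # p) r" using less.prems by (intro is_path_Cons) (auto simp: sel)
      then show ?thesis using p v A_par[OF less.prems False] by (intro exI[of _ "v # p"]) fastforce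
    qed
  qed
  have to_root: "(v, r) \<in> (adj T)\<^sup>*" if v: "v \<in> V" for v
  proof -
    obtain p where "is_path T v p r" using path[OF v] by blast
    then have "(v, r) \<in> (adj T \<inter> UNIV \<times> UNIV)\<^sup>*" by (rule path_imp_rtrancl) simp
    then show ?thesis by simp
  qed
  have no_cycle: "\<not> is_cycle T p" for p
  proof
    assume cyc: "is_cycle T p"
    then have "set p \<noteq> {}" by (auto simp: is_cycle_def)
    then obtain u where u: "u \<in> set p" "\<And>v. v \<in> set p \<Longrightarrow> h u \<le> h v"
      using ex_min_if_finite[of "h ` set p"] by (meson arg_min_least arg_min_if_finite(1) List.finite_set)
    have up: "v = par u" if "v \<in> set p" "{u, v} \<in> edges T" for v
    proof -
      obtain x where x: "x \<in> V" "x \<noteq> r" "{u, v} = {x, par x}" using \<open>{u, v} \<in> edges T\<close> by (auto simp: sel)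
      then show ?thesis using par[OF x(1,2)] u(2)[OF that(1)] by (auto simp: doubleton_eq_iff)
    qed
    show False using cycle_two_neighbours[OF cyc u(1)] up by metis
  qed
  have "simple_graph T"
    unfolding simple_graph_def sel
  proof (intro conjI ballI fin)
    fix e assume "e \<in> {{v, par v} | v. v \<in> V \<and> v \<noteq> r}"
    then obtain v where "v \<in> V" "v \<noteq> r" "e = {v, par v}" by blast
    moreover from this have "v \<noteq> par v" "par v \<in> V" using par[of v] by auto
    ultimately show "\<exists>u w. u \<in> V \<and> w \<in> V \<and> u \<noteq> w \<and> e = {u, w}" by blast
  qed
  moreover have "connected_graph T"
    unfolding connected_graph_def sel using r to_root rtrancl_sym[OF sym_adj] by (meson empty_iff rtrancl_trans)
  ultimately show tree: "is_tree T" using no_cycle by (simp add: is_tree_def)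
  show "anc T v = A v" if "v \<in> V" for v
    using path[OF that] anc_path[OF tree, of v] r by (auto simp: sel)
qed

text \<open>The vertices are the nonempty clusters together with X as root and the singletons as
  leaves. These changes to F do not affect the triples: a singleton cannot contain both a and b, X
  cannot miss c, and the empty set contains nothing. For \<open>X = {}\<close> the result is the
  one-vertex tree.\<close>

lemma laminar_rooted_tree:
  fixes X :: "'a set"
  assumes F: "laminar F" "F \<subseteq> Pow X" and finX: "finite X" and card: "X = {} \<or> 2 \<le> card X"
  obtains T :: "('a + nat) rooted_graph" where "rooted_tree T" "leaves T = Inl ` X"
    "\<And>t. emb t \<in> displayed T \<longleftrightarrow> t \<in> cluster_triples X F"
proof -
  define H where "H = insert X (F - {{}} \<union> (\<lambda>x. {x}) ` X)"
  have H_X: "X \<in> H" and H_single: "\<And>x. x \<in> X \<Longrightarrow> {x} \<in> H" and H_sub: "\<And>C. C \<in> H \<Longrightarrow> C \<subseteq> X"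
    using F(2) by (auto simp: H_def)
  have finH: "finite H" using H_sub finX by (meson Pow_iff finite_Pow_iff rev_finite_subset subsetI)
  have H_ne: "C \<noteq> {}" if "C \<in> H" "C \<noteq> X" for C using that by (auto simp: H_def)
  have lam: "C \<inter> D = {} \<or> C \<subseteq> D \<or> D \<subseteq> C" if "C \<in> H" "D \<in> H" for C D
    using that F unfolding H_def laminar_def by auto
  have X_not_single: "X \<noteq> {x}" for x using card by auto

  \<comment> \<open>Proper superclusters of a nonempty C share an element and so form a chain; the
    intersection is the smallest of them. At the root X it has the default value
    \<open>UNIV\<close>, and the edges of T leave out the root.\<close>
  define par where "par C = \<Inter>{D \<in> H. C \<subset> D}" for C
  have par_least: "par C \<subseteq> D" if "D \<in> H" "C \<subset> D" for C D using that by (auto simp: par_def)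
  have par: "par C \<in> H" "C \<subset> par C" if C: "C \<in> H" "C \<noteq> X" for C
  proof -
    let ?S = "{D \<in> H. C \<subset> D}"
    have "X \<in> ?S" using C H_X H_sub by blast
    then obtain M where M: "M \<in> ?S" "\<And>D. D \<in> ?S \<Longrightarrow> D \<subseteq> M \<Longrightarrow> M = D"
      using finite_has_minimal[of ?S] finH by auto
    have "M \<subseteq> D" if "D \<in> ?S" for D
    proof -
      have "C \<subseteq> M \<inter> D" "C \<noteq> {}" using M(1) that H_ne[OF C] by auto
      then show ?thesis using lam[of M D] M that by blast
    qed
    then have "par C = M" unfolding par_def using M(1) by blast
    then show "par C \<in> H" "C \<subset> par C" using M(1) by auto
  qed
  \<comment> \<open>A maximal proper subcluster of C through x is a child of C; \<open>{x}\<close>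
    shows that there is one to choose from.\<close>
  have child: "\<exists>D\<in>H. x \<in> D \<and> D \<noteq> X \<and> D \<subset> C \<and> par D = C" if C: "C \<in> H" "x \<in> C" "C \<noteq> {x}" for C x
  proof -
    let ?S = "{D \<in> H. x \<in> D \<and> D \<subset> C}"
    have "{x} \<in> ?S" using C H_sub H_single by blast
    then obtain M where M: "M \<in> ?S" "\<And>D. D \<in> ?S \<Longrightarrow> M \<subseteq> D \<Longrightarrow> M = D"
      using finite_has_maximal[of ?S] finH by auto
    have "M \<noteq> X" using M(1) C H_sub by blast
    moreover have "par M = C"
    proof (rule ccontr)
      assume "par M \<noteq> C"
      then have "par M \<in> ?S" using par[of M] par_least[of C M] M(1) C \<open>M \<noteq> X\<close> by blast
      then show False using M par(2)[of M] \<open>M \<noteq> X\<close> by blast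
    qed
    ultimately show ?thesis using M(1) by blast
  qed

  obtain g :: "'a set \<Rightarrow> nat" where g: "inj_on g H"
    using finite_imp_inj_to_nat_seg[OF finH] by blast
  \<comment> \<open>Singletons become the prescribed leaves; all other clusters, including an empty
    root, are numbered on the \<open>nat\<close> side.\<close>
  define f :: "'a set \<Rightarrow> 'a + nat" where "f C = (if is_singleton C then Inl (the_elem C) else Inr (g C))" for C
  have f_single: "f {x} = Inl x" for x by (simp add: f_def)
  have f_Inl: "f C = Inl x \<longleftrightarrow> C = {x}" for C x
    by (auto simp: f_def is_singleton_def)
  have inj: "inj_on f H"
  proof (rule inj_onI)
    fix C D assume CD: "C \<in> H" "D \<in> H" "f C = f D"
    show "C = D"
    proof (cases "is_singleton C")
      case True
      then show ?thesis using CD(3) f_Inl f_single by (metis is_singleton_def)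
    next
      case False
      then show ?thesis using CD inj_onD[OF g] by (auto simp: f_def split: if_splits)
    qed
  qed
  then have f_eq: "f C = f D \<longleftrightarrow> C = D" if "C \<in> H" "D \<in> H" for C D using that by (auto dest: inj_onD)
  define k where "k = inv_into H f"
  have k: "k (f C) = C" if "C \<in> H" for C using that inj by (simp add: k_def)

  define T where
    "T = \<lparr>verts = f ` H, edges = {{v, f (par (k v))} | v. v \<in> f ` H \<and> v \<noteq> f X}, root = f X\<rparr>"
  \<comment> \<open>The root path of a cluster consists of its superclusters.\<close>
  define A where "A v = f ` {D \<in> H. k v \<subseteq> D}" for v
  have "{D \<in> H. X \<subseteq> D} = {X}" using H_X H_sub by blast
  then have A_X: "A (f X) = {f X}" using H_X by (simp add: A_def k)
  have A_par: "A v = insert v (A (f (par (k v))))" if v: "v \<in> f ` H" "v \<noteq> f X" for v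
  proof -
    obtain C where C: "C \<in> H" "C \<noteq> X" "v = f C" using v by blast
    have "{D \<in> H. C \<subseteq> D} = insert C {D \<in> H. par C \<subseteq> D}"
      using C(1) par[OF C(1,2)] par_least[of _ C] by blast
    then show ?thesis using C par[OF C(1,2)] by (simp add: A_def k)
  qed
  have up: "f (par (k v)) \<in> f ` H \<and> card (k v) < card (k (f (par (k v))))"
    if v: "v \<in> f ` H" "v \<noteq> f X" for v
  proof -
    obtain C where C: "C \<in> H" "C \<noteq> X" "v = f C" using v by blast
    have "finite (par C)" using par[OF C(1,2)] H_sub finX finite_subset by metis
    then have "card C < card (par C)" using par[OF C(1,2)] by (intro psubset_card_mono)
    then show ?thesis using C par[OF C(1,2)] by (simp add: k)
  qed
  \<comment> \<open>The size of a cluster serves as height, because a parent properly contains its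
    children.\<close>
  have tree: "is_tree T" and anc: "\<And>v. v \<in> f ` H \<Longrightarrow> anc T v = A v"
    using parent_tree[where V = "f ` H" and r = "f X" and par = "\<lambda>v. f (par (k v))"
        and h = "\<lambda>v. card (k v)" and A = A and T = T, OF _ _ up A_X A_par T_def] finH H_X by blast+

  have edges: "edges T = (\<lambda>C. {f C, f (par C)}) ` (H - {X})"
    unfolding T_def using k H_X by (auto simp: f_eq image_iff) 
  have fin_edges: "finite (edges T)" using finH by (simp add: edges)
  have edge_up: "{f C, f (par C)} \<in> edges T" if "C \<in> H" "C \<noteq> X" for C using that by (auto simp: edges)
  have degree_single: "degree T (f {x}) = 1" if "x \<in> X" for x
  proof -
    have "{e \<in> edges T. f {x} \<in> e} = {{f {x}, f (par {x})}}"
    proof (intro equalityI subsetI)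
      fix e assume "e \<in> {e \<in> edges T. f {x} \<in> e}"
      then obtain D where D: "D \<in> H" "D \<noteq> X" "e = {f D, f (par D)}" "f {x} \<in> e" by (auto simp: edges)
      have "par D \<noteq> {x}" using par(2)[OF D(1,2)] H_ne[OF D(1,2)] by auto
      then have "D = {x}" using D f_eq[of "{x}"] H_single[OF that] par[OF D(1,2)] by auto
      then show "e \<in> {{f {x}, f (par {x})}}" using D by simp
    qed (use edge_up[OF H_single[OF that]] X_not_single in auto)
    then show ?thesis by (simp add: degree_def)
  qed
  \<comment> \<open>A child through x and a child through a point y outside it give two edges. Below
    the root the edge to the parent is a third one; at the root two are enough to exclude a
    leaf.\<close>
  have degree_inner: "(if C = X then 2 else 3) \<le> degree T (f C)"
    if C: "C \<in> H" "C \<noteq> {}" "\<And>x. C \<noteq> {x}" for C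
  proof -
    obtain x where "x \<in> C" using C by blast
    then obtain D where D: "D \<in> H" "D \<noteq> X" "D \<subset> C" "par D = C" using child C by blast
    then obtain y where y: "y \<in> C" "y \<notin> D" by blast
    then obtain D' where D': "D' \<in> H" "D' \<noteq> X" "D' \<subset> C" "par D' = C" "y \<in> D'" using child C by blast
    let ?N = "{e \<in> edges T. f C \<in> e}"
    have finN: "finite ?N" using fin_edges by simp
    have sub: "{{f D, f C}, {f D', f C}} \<subseteq> ?N"
      using edge_up[OF D(1,2)] edge_up[OF D'(1,2)] D(4) D'(4) by simp
    have "f D \<noteq> f D'" "f D \<noteq> f C" using D(1,3) D'(1,5) y C(1) f_eq by blast+
    then have neq: "{f D, f C} \<noteq> {f D', f C}" by (simp add: doubleton_eq_iff)
    show ?thesis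
    proof (cases "C = X")
      case True
      then show ?thesis using card_mono[OF finN sub] neq by (simp add: degree_def)
    next
      case False
      have "f (par C) \<noteq> f D" "f (par C) \<noteq> f D'" "f (par C) \<noteq> f C"
        using D(1,3) D'(1,3) C(1) par[OF C(1) False] f_eq by blast+
      then have "{f C, f (par C)} \<noteq> {f D, f C}" "{f C, f (par C)} \<noteq> {f D', f C}"
        by (simp_all add: doubleton_eq_iff)
      moreover have sub: "{{f C, f (par C)}, {f D, f C}, {f D', f C}} \<subseteq> ?N"
        using sub edge_up[OF C(1) False] by auto
      ultimately show ?thesis using card_mono[OF finN sub] neq False by (simp add: degree_def)
    qed
  qed
  have degree_empty: "degree T (f {}) = 0" if "{} \<in> H"
  proof -
    have "X = {}" using that H_ne by blast
    then have "edges T = {}" using H_sub by (auto simp: edges)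
    then show ?thesis by (simp add: degree_def)
  qed
  have degree_1: "degree T (f C) = 1 \<longleftrightarrow> (\<exists>x\<in>X. C = {x})" if "C \<in> H" for C
    using degree_single degree_inner[OF that] degree_empty that H_sub[OF that]
    by (cases "C = {}"; cases "\<exists>x. C = {x}") (auto split: if_splits)
  have verts: "verts T = f ` H" "root T = f X" by (simp_all add: T_def)
  have leaves: "leaves T = Inl ` X"
  proof (intro equalityI subsetI)
    fix v assume "v \<in> leaves T"
    then show "v \<in> Inl ` X" using degree_1 f_single by (auto simp: leaves_def verts)
  next
    fix v :: "'a + nat" assume "v \<in> Inl ` X"
    then obtain x where "x \<in> X" "v = f {x}" using f_single by auto
    then show "v \<in> leaves T" using degree_single H_single by (auto simp: leaves_def verts)
  qed
  have rooted: "rooted_tree T"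
    unfolding rooted_tree_def
  proof (intro conjI tree ballI impI)
    have "f X \<notin> Inl ` X" using f_Inl X_not_single by blast
    then show "root T \<in> verts T - leaves T" using H_X by (simp add: leaves verts)
  next
    fix v assume v: "v \<in> verts T - leaves T" "v \<noteq> root T"
    then obtain C where C: "C \<in> H" "v = f C" "C \<noteq> X" by (auto simp: verts)
    have "C \<noteq> {x}" for x using v C H_sub[OF C(1)] f_single by (auto simp: leaves)
    then show "3 \<le> degree T v" using degree_inner[OF C(1) H_ne[OF C(1,3)]] C by simp
  qed
  have iff: "\<not> anc T (Inl a) \<inter> anc T (Inl b) \<subseteq> anc T (Inl c) \<longleftrightarrow> (\<exists>C\<in>F. a \<in> C \<and> b \<in> C \<and> c \<notin> C)"
    if abc: "distinct [a, b, c]" "{a, b, c} \<subseteq> X" for a b c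
  proof -
    have anc_x: "anc T (Inl x) = f ` {D \<in> H. x \<in> D}" if "x \<in> X" for x
    proof -
      have "anc T (f {x}) = f ` {D \<in> H. {x} \<subseteq> D}"
        using anc[of "f {x}"] H_single[OF that] unfolding A_def k[OF H_single[OF that]] by blast
      then show ?thesis by (simp add: f_single)
    qed
    have "\<not> anc T (Inl a) \<inter> anc T (Inl b) \<subseteq> anc T (Inl c) \<longleftrightarrow> (\<exists>C\<in>H. a \<in> C \<and> b \<in> C \<and> c \<notin> C)"
      using abc(2) f_eq by (auto simp: anc_x)
    also have "\<dots> \<longleftrightarrow> (\<exists>C\<in>F. a \<in> C \<and> b \<in> C \<and> c \<notin> C)"
      using abc by (auto simp: H_def)
    finally show ?thesis .
  qed
  have "emb t \<in> displayed T \<longleftrightarrow> t \<in> cluster_triples X F" for t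
    unfolding emb_in_displayed[OF rooted] cluster_triples_def leaves mem_Collect_eq
    using iff by (intro iff_exI conj_cong refl) auto
  then show thesis using that rooted leaves by blast
qed

section \<open>Consistency and closure in terms of laminar families\<close>

lemma leaf_set_triple: "triple a b c \<in> R \<Longrightarrow> {a, b, c} \<subseteq> leaf_set R"
  unfolding leaf_set_def by (rule order_trans[OF _ UN_upper]) auto

lemma consistentE:
  assumes "consistent R"
  obtains F where "laminar F" "R \<subseteq> cluster_triples (leaf_set R) F"
proof -
  obtain T :: "('a + nat) rooted_graph" where T: "rooted_tree T" "emb ` R \<subseteq> displayed T"
    using assms unfolding consistent_def by blast
  obtain F where F: "laminar F" "\<And>t. emb t \<in> displayed T \<longleftrightarrow> t \<in> cluster_triples {x. Inl x \<in> leaves T} F"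
    using rooted_tree_laminar[OF T(1)] by blast
  have "R \<subseteq> cluster_triples (leaf_set R) F"
  proof
    fix t assume t: "t \<in> R"
    then have "t \<in> cluster_triples {x. Inl x \<in> leaves T} F" using T(2) F(2) by blast
    then obtain a b c where "t = triple a b c" "distinct [a, b, c]" "\<exists>C\<in>F. a \<in> C \<and> b \<in> C \<and> c \<notin> C"
      unfolding cluster_triples_def by blast
    moreover from this have "{a, b, c} \<subseteq> leaf_set R" using t leaf_set_triple by metis
    ultimately show "t \<in> cluster_triples (leaf_set R) F" by (simp add: triple_in_cluster_triples)
  qed
  then show ?thesis using that F(1) by blast
qed

lemma finite_leaf_set:
  assumes "triple_set R" "finite R"
  shows "finite (leaf_set R)"
  unfolding leaf_set_def using assms by (auto simp: triple_set_def is_triple_def)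

lemma leaf_set_card:
  assumes "triple_set R" "finite R"
  shows "leaf_set R = {} \<or> 2 \<le> card (leaf_set R)"
proof (cases "R = {}")
  case False
  then obtain t where t: "t \<in> R" by blast
  then obtain a b c where abc: "t = triple a b c" "distinct [a, b, c]"
    using assms(1) unfolding triple_set_def is_triple_def by blast
  have "triple a b c \<in> R" using t unfolding abc(1) .
  from leaf_set_triple[OF this] have "{a, b} \<subseteq> leaf_set R" by simp
  then have "card {a, b} \<le> card (leaf_set R)" by (rule card_mono[OF finite_leaf_set[OF assms]])
  then show ?thesis using abc(2) by simp
qed (simp add: leaf_set_def)

text \<open>Together with \<open>consistentE\<close> this removes trees from the rest of the
  argument. \<open>leaf_set_card\<close> provides the size condition under which a family can be
  turned into a tree.\<close>

lemma cl_eq_laminar: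
  assumes "triple_set R" "finite R"
  shows "cl R = (\<Inter>F\<in>{F. laminar F \<and> F \<subseteq> Pow (leaf_set R) \<and> R \<subseteq> cluster_triples (leaf_set R) F}.
    cluster_triples (leaf_set R) F)"
proof (intro equalityI subsetI INT_I)
  fix t F assume t: "t \<in> cl R"
    and "F \<in> {F. laminar F \<and> F \<subseteq> Pow (leaf_set R) \<and> R \<subseteq> cluster_triples (leaf_set R) F}"
  then have F: "laminar F" "F \<subseteq> Pow (leaf_set R)" "R \<subseteq> cluster_triples (leaf_set R) F" by auto
  obtain T :: "('a + nat) rooted_graph" where T: "rooted_tree T" "leaves T = Inl ` leaf_set R"
      "\<And>t. emb t \<in> displayed T \<longleftrightarrow> t \<in> cluster_triples (leaf_set R) F"
    using laminar_rooted_tree[OF F(1,2) finite_leaf_set[OF assms] leaf_set_card[OF assms]] by blast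
  have "emb ` R \<subseteq> displayed T" using T(3) F(3) by blast
  then have "emb t \<in> displayed T" using t T(1,2) unfolding cl_def by blast
  then show "t \<in> cluster_triples (leaf_set R) F" using T(3) by blast
next
  fix t assume t: "t \<in> (\<Inter>F\<in>{F. laminar F \<and> F \<subseteq> Pow (leaf_set R) \<and>
    R \<subseteq> cluster_triples (leaf_set R) F}. cluster_triples (leaf_set R) F)"
  have "emb t \<in> displayed T"
    if T: "rooted_tree T" "leaves T = Inl ` leaf_set R" "emb ` R \<subseteq> displayed T"
    for T :: "('a + nat) rooted_graph"
  proof -
    obtain F where F: "laminar F" "\<And>t. emb t \<in> displayed T \<longleftrightarrow> t \<in> cluster_triples {x. Inl x \<in> leaves T} F"
      using rooted_tree_laminar[OF T(1)] by blast
    obtain G where G: "laminar G" "G \<subseteq> Pow (leaf_set R)"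
        "cluster_triples (leaf_set R) G = cluster_triples (leaf_set R) F"
      using laminar_restrict[OF F(1)] by blast
    have "{x. (Inl x :: 'a + nat) \<in> leaves T} = leaf_set R" using T(2) by auto
    then have eq: "emb t \<in> displayed T \<longleftrightarrow> t \<in> cluster_triples (leaf_set R) G" for t
      using F(2) G(3) by simp
    then have "R \<subseteq> cluster_triples (leaf_set R) G" using T(3) by blast
    then show ?thesis using t eq G(1,2) by blast
  qed
  then show "t \<in> cl R" unfolding cl_def by blast
qed

section \<open>Ahographs and laminar families\<close>

abbreviation aho :: "'a triple set \<Rightarrow> 'a set \<Rightarrow> ('a \<times> 'a) set" where
  "aho R S \<equiv> adj (ahograph R S)"

lemma verts_ahograph: "verts (ahograph R S) = S"
  by (simp add: ahograph_def)

lemma aho_iff: "(x, y) \<in> aho R S \<longleftrightarrow> x \<in> S \<and> y \<in> S \<and> x \<noteq> y \<and> (\<exists>z\<in>S. triple x y z \<in> R)"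
  unfolding adj_def ahograph_def by (auto simp: doubleton_eq_iff insert_commute)

lemma aho_rtrancl_sym: "(x, y) \<in> (aho R S)\<^sup>* \<Longrightarrow> (y, x) \<in> (aho R S)\<^sup>*"
  by (rule rtrancl_sym[OF sym_adj])

lemma aho_rtrancl_mono: "S \<subseteq> S' \<Longrightarrow> (aho R S)\<^sup>* \<subseteq> (aho R S')\<^sup>*"
  by (rule rtrancl_mono) (auto simp: aho_iff subset_iff)

lemma aho_rtrancl_closed: "(x, y) \<in> (aho R S)\<^sup>* \<Longrightarrow> x \<in> S \<Longrightarrow> y \<in> S"
  by (induction rule: rtrancl_induct) (auto simp: aho_iff)

text \<open>For x in S this is the component of x in the Ahograph; for x outside S it is
  \<open>{x}\<close>.\<close>

definition aho_class :: "'a triple set \<Rightarrow> 'a set \<Rightarrow> 'a \<Rightarrow> 'a set" where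
  "aho_class R S x = {y. (x, y) \<in> (aho R S)\<^sup>*}"

lemma aho_class_iff: "y \<in> aho_class R S x \<longleftrightarrow> (x, y) \<in> (aho R S)\<^sup>*"
  by (simp add: aho_class_def)

lemma aho_class_refl: "x \<in> aho_class R S x"
  by (simp add: aho_class_iff)

lemma aho_class_eq: "y \<in> aho_class R S x \<Longrightarrow> aho_class R S y = aho_class R S x"
  unfolding aho_class_def mem_Collect_eq
  by (intro Collect_cong iffI) (meson aho_rtrancl_sym rtrancl_trans)+

lemma aho_class_subset: "x \<in> S \<Longrightarrow> aho_class R S x \<subseteq> S"
  using aho_rtrancl_closed by (auto simp: aho_class_iff)

lemma aho_class_mono: "S \<subseteq> S' \<Longrightarrow> aho_class R S x \<subseteq> aho_class R S' x"
  using aho_rtrancl_mono[of S S' R] by (auto simp: aho_class_iff)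

section \<open>Consistency disconnects Ahographs\<close>

context
  fixes R :: "'a triple set" and F :: "'a set set" and X :: "'a set"
  assumes lam: "laminar F" and R_F: "R \<subseteq> cluster_triples X F"
begin

text \<open>Two clusters through y are nested, and the larger one serves for x and z. So common
  clusters that do not contain S can be chained along a path of the Ahograph.\<close>

lemma laminar_common_cluster_trans:
  assumes "C \<in> F" "x \<in> C" "y \<in> C" "\<not> S \<subseteq> C" "D \<in> F" "y \<in> D" "z \<in> D" "\<not> S \<subseteq> D"
  shows "\<exists>E\<in>F. x \<in> E \<and> z \<in> E \<and> \<not> S \<subseteq> E"
proof -
  have "C \<subseteq> D \<or> D \<subseteq> C" using lam assms unfolding laminar_def by blast
  then show ?thesis using assms by blast
qed

lemma aho_rtrancl_common_cluster:
  assumes "(x, y) \<in> (aho R S)\<^sup>*" "x \<noteq> y"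
  shows "\<exists>C\<in>F. x \<in> C \<and> y \<in> C \<and> \<not> S \<subseteq> C"
  using assms
proof (induction rule: rtrancl_induct)
  case (step y z)
  \<comment> \<open>The witness w lies in S, so a cluster that contains y and z but not w cannot
    contain S.\<close>
  obtain w where "w \<in> S" "triple y z w \<in> R" using step.hyps(2) by (auto simp: aho_iff)
  then have "\<exists>D\<in>F. y \<in> D \<and> z \<in> D \<and> \<not> S \<subseteq> D"
    using R_F triple_in_cluster_triples[of y z w X F] by blast
  then show ?case using step laminar_common_cluster_trans by metis
qed simp

text \<open>Otherwise each z in \<open>S - {x}\<close> has a cluster with x that does not contain S.
  All of them contain x and so form a chain; a maximal one contains every z, hence all of S.\<close>

lemma no_common_cluster:
  assumes S: "finite S" "x \<in> S" "y \<in> S" "x \<noteq> y"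
  shows "\<exists>z\<in>S - {x}. \<forall>C\<in>F. x \<in> C \<and> z \<in> C \<longrightarrow> S \<subseteq> C"
proof (rule ccontr)
  assume "\<not> ?thesis"
  then have "\<forall>z\<in>S - {x}. \<exists>C. C \<in> F \<and> x \<in> C \<and> z \<in> C \<and> \<not> S \<subseteq> C" by blast
  then obtain c where c: "\<And>z. z \<in> S - {x} \<Longrightarrow> c z \<in> F \<and> x \<in> c z \<and> z \<in> c z \<and> \<not> S \<subseteq> c z"
    by metis
  have "finite (c ` (S - {x}))" "c ` (S - {x}) \<noteq> {}" using S by auto
  then obtain M where M: "M \<in> c ` (S - {x})" "\<And>C. C \<in> c ` (S - {x}) \<Longrightarrow> M \<subseteq> C \<Longrightarrow> M = C"
    by (meson finite_has_maximal)
  have "z \<in> M" if z: "z \<in> S - {x}" for z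
  proof -
    have "c z \<inter> M \<noteq> {}" "c z \<in> F" "M \<in> F" using c z M(1) by blast+
    then have "c z \<subseteq> M" using lam M(2)[of "c z"] z unfolding laminar_def by blast
    then show ?thesis using c[OF z] by blast
  qed
  then have "S \<subseteq> M" using M(1) c by blast
  then show False using M(1) c by blast
qed

lemma aho_disconnected:
  assumes "finite S" "x \<in> S" "y \<in> S" "x \<noteq> y"
  shows "\<exists>z\<in>S. (x, z) \<notin> (aho R S)\<^sup>*"
  using no_common_cluster[OF assms] aho_rtrancl_common_cluster assms by (metis DiffE insertCI)

end

text \<open>The condition that A and B are the two components of the graph on their union, see
  \<open>components_eq_pair_iff\<close>. In terms of classes it combines directly with
  \<open>aho_class_mono\<close> and \<open>aho_class_eq\<close>.\<close>

definition splits :: "'a triple set \<Rightarrow> 'a set \<Rightarrow> 'a set \<Rightarrow> bool" where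
  "splits R A B \<longleftrightarrow> A \<noteq> {} \<and> B \<noteq> {} \<and> A \<inter> B = {} \<and>
     (\<forall>x\<in>A. aho_class R (A \<union> B) x = A) \<and> (\<forall>x\<in>B. aho_class R (A \<union> B) x = B)"

lemma splits_commute: "splits R A B \<longleftrightarrow> splits R B A"
  unfolding splits_def Un_commute[of A B] by blast

lemma splits_disjoint: "splits R A B \<Longrightarrow> A \<inter> B = {}"
  by (simp add: splits_def)

lemma splitsD1: "splits R A B \<Longrightarrow> x \<in> A \<Longrightarrow> aho_class R (A \<union> B) x = A"
  by (simp add: splits_def)

lemma splitsD2: "splits R A B \<Longrightarrow> x \<in> B \<Longrightarrow> aho_class R (A \<union> B) x = B"
  by (simp add: splits_def)

lemma components_eq_pair_iff:
  "A \<noteq> B \<and> components (ahograph R (A \<union> B)) = {A, B} \<longleftrightarrow> splits R A B"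
proof
  let ?K = "aho_class R (A \<union> B)"
  have comps: "components (ahograph R (A \<union> B)) = ?K ` (A \<union> B)"
    unfolding components_def verts_ahograph aho_class_def ..
  {
    assume *: "A \<noteq> B \<and> components (ahograph R (A \<union> B)) = {A, B}"
    then have "A \<in> ?K ` (A \<union> B)" "B \<in> ?K ` (A \<union> B)" unfolding comps by simp_all
    then obtain a b where ab: "?K a = A" "?K b = B" by (auto elim!: imageE)
    then have A: "?K x = A" if "x \<in> A" for x using aho_class_eq[of x R "A \<union> B" a] that by simp
    have B: "?K x = B" if "x \<in> B" for x using aho_class_eq[of x R "A \<union> B" b] ab that by simp
    have "a \<in> A" "b \<in> B" using ab aho_class_refl by metis+
    moreover have "A \<inter> B = {}" using A B conjunct1[OF *] by (metis disjoint_iff)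
    ultimately show "splits R A B" unfolding splits_def by (intro conjI ballI A B) auto
  next
    assume *: "splits R A B"
    then have "A \<noteq> B" "A \<noteq> {}" "B \<noteq> {}" by (auto simp: splits_def)
    moreover from this have "?K ` A = {A}" "?K ` B = {B}"
      using splitsD1[OF *] splitsD2[OF *] by (auto simp: image_iff)
    ultimately show "A \<noteq> B \<and> components (ahograph R (A \<union> B)) = {A, B}"
      unfolding comps by (simp add: image_Un insert_commute)
  }
qed

lemma Lsets_iff:
  "P \<in> Lsets t R \<longleftrightarrow>
    (\<exists>A B. P = {A, B} \<and> A \<union> B \<subseteq> leaf_set R \<and> splits R A B \<and> fst t \<subseteq> A \<and> snd t \<in> B)"
  unfolding Lsets_def mem_Collect_eq using components_eq_pair_iff by (metis Un_subset_iff)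

text \<open>In a laminar family displaying \<open>R\<close>, the maximal clusters not containing \<open>A \<union> B\<close> cut
  \<open>A \<union> B\<close> into at least two unions of components, so they separate \<open>A\<close> from \<open>B\<close>.\<close>

lemma splits_displayed:
  assumes lam: "laminar F" and R_F: "R \<subseteq> cluster_triples X F" and fin: "finite (A \<union> B)"
    and split: "splits R A B" and abc: "a \<in> A" "b \<in> A" "a \<noteq> b" "c \<in> B"
  shows "\<exists>C\<in>F. a \<in> C \<and> b \<in> C \<and> c \<notin> C"
proof -
  let ?S = "A \<union> B"
  note common = aho_rtrancl_common_cluster[OF lam R_F, of _ _ ?S]
  have A: "(a, x) \<in> (aho R ?S)\<^sup>*" if "x \<in> A" for x
    using splitsD1[OF split abc(1)] that by (simp flip: aho_class_iff)
  have B: "(c, x) \<in> (aho R ?S)\<^sup>*" if "x \<in> B" for x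
    using splitsD2[OF split abc(4)] that by (simp flip: aho_class_iff)
  obtain C where C: "C \<in> F" "a \<in> C" "b \<in> C" "\<not> ?S \<subseteq> C" using common[OF A] abc by blast
  have "c \<notin> C"
  proof
    assume c: "c \<in> C"
    \<comment> \<open>No cluster through a and z fails to contain the whole vertex set, so z cannot
      be connected to a and lies in B. But C joins a to c, and connectedness of B gives a cluster D
      joining c to z; chaining the two contradicts the choice of z.\<close>
    obtain z where z: "z \<in> ?S - {a}" "\<And>C. C \<in> F \<Longrightarrow> a \<in> C \<Longrightarrow> z \<in> C \<Longrightarrow> ?S \<subseteq> C"
      using no_common_cluster[OF lam R_F fin, of a b] abc by blast
    then have "z \<in> B" "z \<noteq> c" using common[OF A, of z] C c by blast+
    then obtain D where "D \<in> F" "c \<in> D" "z \<in> D" "\<not> ?S \<subseteq> D" using common[OF B, of z] by blast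
    then show False using z(2) laminar_common_cluster_trans[OF lam R_F C(1,2) c C(4)] by metis
  qed
  then show ?thesis using C by blast
qed

text \<open>Classes only grow with the vertex set, so the classes of a and b cover the union. If
  they coincided, the graph would be connected, against \<open>aho_disconnected\<close>.\<close>

lemma splits_join:
  assumes lam: "laminar F" and R_F: "R \<subseteq> cluster_triples X F" 
    and fin: "finite (A \<union> B)" "finite (A' \<union> B')"
    and split: "splits R A B" "splits R A' B'" and ne: "A \<inter> A' \<noteq> {}" "B \<inter> B' \<noteq> {}"
  shows "splits R (A \<union> A') (B \<union> B')"
proof -
  let ?S = "(A \<union> A') \<union> (B \<union> B')"
  let ?K = "aho_class R ?S"
  obtain a b where ab: "a \<in> A" "a \<in> A'" "b \<in> B" "b \<in> B'" using ne by blast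
  have mono: "aho_class R (A \<union> B) x \<subseteq> ?K x" "aho_class R (A' \<union> B') x \<subseteq> ?K x" for x
    by (rule aho_class_mono; blast)+
  have a: "A \<union> A' \<subseteq> ?K a"
    using mono[of a] splitsD1[OF split(1) ab(1)] splitsD1[OF split(2) ab(2)] by simp
  have b: "B \<union> B' \<subseteq> ?K b"
    using mono[of b] splitsD2[OF split(1) ab(3)] splitsD2[OF split(2) ab(4)] by simp
  have "a \<noteq> b" using ab splits_disjoint[OF split(1)] by blast
  then obtain z where z: "z \<in> ?S" "z \<notin> ?K a"
    using aho_disconnected[OF lam R_F, of ?S a b] fin ab by (auto simp: aho_class_iff)
  then have "?K a \<noteq> ?K b" using a b by blast
  then have disj: "?K a \<inter> ?K b = {}" using aho_class_eq by (metis disjoint_iff)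
  have "?K a \<subseteq> ?S" "?K b \<subseteq> ?S" by (rule aho_class_subset; use ab in blast)+
  then have eq: "?K a = A \<union> A'" "?K b = B \<union> B'" using a b disj by blast+
  have "?K x = A \<union> A'" if "x \<in> A \<union> A'" for x
    using aho_class_eq[of x R ?S a] that unfolding eq .
  moreover have "?K x = B \<union> B'" if "x \<in> B \<union> B'" for x
    using aho_class_eq[of x R ?S b] that unfolding eq .
  ultimately show ?thesis using ab disj unfolding eq splits_def by blast
qed

text \<open>The trees below a set \<open>K\<close> of components and below each remaining component are glued together
  under a new root.\<close>

lemma glue:
  fixes R :: "'a triple set" and S K :: "'a set" and F F' :: "'a set set"
  defines "Q \<equiv> aho_class R S"
  defines "G \<equiv> insert K F' \<union> {C \<inter> Q x | C x. C \<in> insert UNIV F \<and> x \<in> S - K}"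
  assumes lam: "laminar F" and R_F: "R \<subseteq> cluster_triples X F"
    and K: "K \<subseteq> S" "\<And>x. x \<in> K \<Longrightarrow> Q x \<subseteq> K"
    and F': "laminar F'" "F' \<subseteq> Pow K" "R \<inter> cluster_triples K UNIV \<subseteq> cluster_triples K F'"
  shows "laminar G" and "G \<subseteq> Pow S" and "R \<inter> cluster_triples S UNIV \<subseteq> cluster_triples S G"
proof -
  have Q_eq: "Q y = Q x" if "y \<in> Q x" for x y
    using that unfolding Q_def by (rule aho_class_eq)
  have Q_refl: "x \<in> Q x" for x unfolding Q_def by (rule aho_class_refl)
  have Q_K: "Q x \<inter> K = {}" if "x \<in> S - K" for x
    using K(2) Q_eq Q_refl that by blast
  have G_old: "insert K F' \<subseteq> G" unfolding G_def by (rule Un_upper1)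
  have Q_disj: "Q x \<inter> Q y = {} \<or> Q x = Q y" for x y using Q_eq by blast
  have old: "C \<subseteq> K" if "C \<in> insert K F'" for C using that F'(2) by blast
  have lam_old: "laminar (insert K F')" using F'(1,2) unfolding laminar_def by blast
  \<comment> \<open>\<open>UNIV\<close> makes the whole component \<open>Q x\<close> one of the new
    clusters.\<close>
  have lam_U: "laminar (insert UNIV F)" using lam unfolding laminar_def by blast
  have lam_new: "C \<inter> Q x \<inter> (D \<inter> Q y) = {} \<or> C \<inter> Q x \<subseteq> D \<inter> Q y \<or> D \<inter> Q y \<subseteq> C \<inter> Q x"
    if "C \<in> insert UNIV F" "D \<in> insert UNIV F" for C D x y
    using lam_U that Q_disj[of x y] unfolding laminar_def by blast
  show "laminar G"
    unfolding laminar_def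
  proof (intro ballI)
    fix C D assume "C \<in> G" "D \<in> G"
    then consider "C \<in> insert K F'" "D \<in> insert K F'"
      | x D' where "C \<in> insert K F'" "x \<in> S - K" "D = D' \<inter> Q x"
      | x C' where "D \<in> insert K F'" "x \<in> S - K" "C = C' \<inter> Q x"
      | x y C' D' where "C = C' \<inter> Q x" "D = D' \<inter> Q y" "C' \<in> insert UNIV F" "D' \<in> insert UNIV F"
      unfolding G_def by blast
    then show "C \<inter> D = {} \<or> C \<subseteq> D \<or> D \<subseteq> C"
    proof cases
      case 1
      then show ?thesis using lam_old unfolding laminar_def by blast
    next
      case 2
      have "C \<subseteq> K" "D \<inter> K = {}" using old[OF 2(1)] Q_K[OF 2(2)] 2(3) by auto
      then show ?thesis by blast
    next
      case 3
      have "D \<subseteq> K" "C \<inter> K = {}" using old[OF 3(1)] Q_K[OF 3(2)] 3(3) by auto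
      then show ?thesis by blast
    next
      case 4
      then show ?thesis using lam_new by simp
    qed
  qed
  have Q_S: "Q x \<subseteq> S" if "x \<in> S" for x using that unfolding Q_def by (rule aho_class_subset)
  have "insert K F' \<subseteq> Pow S" using old K(1) by blast
  moreover have "{C \<inter> Q x | C x. C \<in> insert UNIV F \<and> x \<in> S - K} \<subseteq> Pow S" using Q_S by auto
  ultimately show "G \<subseteq> Pow S" unfolding G_def by simp
  show "R \<inter> cluster_triples S UNIV \<subseteq> cluster_triples S G"
  proof
    fix t assume "t \<in> R \<inter> cluster_triples S UNIV"
    then have tR: "t \<in> R" and "t \<in> cluster_triples S UNIV" by simp_all
    from this(2) obtain x y z where t': "t = triple x y z" "distinct [x, y, z]" "{x, y, z} \<subseteq> S"
      by (rule cluster_triplesE)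
    note t = t'(1) tR[unfolded t'(1)] t'(2,3)
    then have "(x, y) \<in> aho R S" unfolding aho_iff by (intro conjI bexI[of _ z]) simp_all
    then have xy: "y \<in> Q x" "x \<in> Q y" by (auto simp: Q_def aho_class_iff intro: aho_rtrancl_sym)
    \<comment> \<open>The cluster comes from \<open>F'\<close> if all three leaves are in K, is K
      itself if only z is outside, and is a cluster of F cut down to \<open>Q x\<close> if x is
      outside.\<close>
    have "\<exists>C\<in>G. x \<in> C \<and> y \<in> C \<and> z \<notin> C"
    proof (cases "x \<in> K")
      case True
      then have y: "y \<in> K" using K(2) xy by blast
      show ?thesis
      proof (cases "z \<in> K")
        case True
        then have "triple x y z \<in> cluster_triples K UNIV"
          using t(3) y \<open>x \<in> K\<close> unfolding triple_in_cluster_triples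
          by (intro conjI bexI[of _ "{x, y}"]) auto
        then have "triple x y z \<in> cluster_triples K F'" using subsetD[OF F'(3) IntI[OF t(2)]] by simp
        then obtain C where "C \<in> F'" "x \<in> C" "y \<in> C" "z \<notin> C"
          unfolding triple_in_cluster_triples by blast
        then show ?thesis using G_old by blast
      next
        case False
        then show ?thesis using y \<open>x \<in> K\<close> G_old by blast
      qed
    next
      case False
      obtain C where C: "C \<in> F" "x \<in> C" "y \<in> C" "z \<notin> C"
        using subsetD[OF R_F t(2)] unfolding triple_in_cluster_triples by blast
      have "x \<in> S - K" using False t(4) by simp
      then have "C \<inter> Q x \<in> G"
        unfolding G_def using C(1) by (intro UnI2 CollectI exI[of _ C] exI[of _ x]) simp
      then show ?thesis using C xy Q_refl by (intro bexI[of _ "C \<inter> Q x"]) auto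
    qed
    then show "t \<in> cluster_triples S G" using t(3,4) unfolding t(1) triple_in_cluster_triples by simp
  qed
qed

text \<open>Induction on the size of S. If a and b are in different components of [R, S], hanging
  all components below a root avoids ab|c. Otherwise let K be the union of the components of a and
  c. If K is smaller than S, the problem passes to K; if K is all of S, then c is in a second
  component by disconnectedness, and the two components are the required pair.\<close>

lemma exists_splits_or_avoiding:
  assumes lam: "laminar F" and R_F: "R \<subseteq> cluster_triples X F"
    and "finite S" and abc: "distinct [a, b, c]" "{a, b, c} \<subseteq> S"
  shows "(\<exists>A B. A \<union> B \<subseteq> S \<and> splits R A B \<and> a \<in> A \<and> b \<in> A \<and> c \<in> B) \<or>
    (\<exists>F'. laminar F' \<and> F' \<subseteq> Pow S \<and> R \<inter> cluster_triples S UNIV \<subseteq> cluster_triples S F' \<and>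
       triple a b c \<notin> cluster_triples S F')"
proof -
  define good where
    "good S \<longleftrightarrow> (\<exists>A B. A \<union> B \<subseteq> S \<and> splits R A B \<and> a \<in> A \<and> b \<in> A \<and> c \<in> B)" for S
  define avoids where
    "avoids S F' \<longleftrightarrow> laminar F' \<and> F' \<subseteq> Pow S \<and>
       R \<inter> cluster_triples S UNIV \<subseteq> cluster_triples S F' \<and> triple a b c \<notin> cluster_triples S F'" for S F'
  have not_displayed: "triple a b c \<notin> cluster_triples S G"
    if "\<And>C. C \<in> G \<Longrightarrow> \<not> (a \<in> C \<and> b \<in> C \<and> c \<notin> C)" for S G
    unfolding triple_in_cluster_triples using that by blast
  have "good S \<or> (\<exists>F'. avoids S F')"
    using assms(3,5)
  proof (induction "card S" arbitrary: S rule: less_induct)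
    case less
    define Q where "Q = aho_class R S"
    have Q_eq: "Q y = Q x" if "y \<in> Q x" for x y
      using that unfolding Q_def by (rule aho_class_eq)
    have Q_refl: "x \<in> Q x" for x unfolding Q_def by (rule aho_class_refl)
    have Q_S: "Q x \<subseteq> S" if "x \<in> S" for x using that unfolding Q_def by (rule aho_class_subset)
    \<comment> \<open>A pair inside K is also one inside S, and an avoiding family on K extends by
      \<open>glue\<close>. The cluster K contains c, and the clusters added outside K lie in
      components that miss a, so ab|c stays avoided.\<close>
    have step: "good S \<or> (\<exists>F'. avoids S F')"
      if K: "K \<subset> S" "\<And>x. x \<in> K \<Longrightarrow> Q x \<subseteq> K" "{a, b, c} \<subseteq> K" for K
    proof -
      have "finite K" using K(1) less.prems(1) finite_subset by blast
      then have "good K \<or> (\<exists>F'. avoids K F')"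
        using less.hyps[OF psubset_card_mono[OF less.prems(1) K(1)]] K(3) by simp
      then show ?thesis
      proof
        assume "good K"
        then have "good S" unfolding good_def using K(1) by (meson psubset_imp_subset subset_trans)
        then show ?thesis ..
      next
        assume "\<exists>F'. avoids K F'"
        then obtain F' where F': "laminar F'" "F' \<subseteq> Pow K"
          "R \<inter> cluster_triples K UNIV \<subseteq> cluster_triples K F'" "triple a b c \<notin> cluster_triples K F'"
          unfolding avoids_def by (elim exE conjE)
        define G where "G = insert K F' \<union> {C \<inter> Q x | C x. C \<in> insert UNIV F \<and> x \<in> S - K}"
        have "laminar G" "G \<subseteq> Pow S" "R \<inter> cluster_triples S UNIV \<subseteq> cluster_triples S G"
          unfolding G_def Q_def
          by (rule glue[OF lam R_F psubset_imp_subset[OF K(1)] K(2)[unfolded Q_def] F'(1-3)]; assumption)+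
        moreover have "\<not> (a \<in> C \<and> b \<in> C \<and> c \<notin> C)" if "C \<in> G" for C
        proof (cases "C \<in> insert K F'")
          case True
          then show ?thesis
            using F'(4) K(3) abc(1) unfolding triple_in_cluster_triples by blast
        next
          case False
          then have "C \<in> {C \<inter> Q x | C x. C \<in> insert UNIV F \<and> x \<in> S - K}"
            using \<open>C \<in> G\<close> unfolding G_def by simp
          then obtain D x where C: "C = D \<inter> Q x" "x \<in> S - K" by auto
          have "Q a \<subseteq> K" using K(2,3) by simp
          then have "a \<notin> Q x" using Q_eq[of a x] Q_refl[of x] C(2) by auto
          then show ?thesis using C(1) by simp
        qed
        ultimately have "avoids S G" unfolding avoids_def using not_displayed by simp
        then show ?thesis by (intro disjI2 exI)
      qed
    qed
    consider "b \<in> Q a" "c \<in> Q a" | "b \<in> Q a" "c \<notin> Q a" | "b \<notin> Q a" by blast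
    then show ?case
    proof cases
      case 1
      \<comment> \<open>Disconnectedness makes the component \<open>Q a\<close> a proper subset of
        S, so the induction can descend to it.\<close>
      obtain z where "z \<in> S" "z \<notin> Q a"
        using aho_disconnected[OF lam R_F less.prems(1), of a b] less.prems(2) abc(1)
        unfolding Q_def aho_class_iff by auto
      then have "Q a \<subset> S" using Q_S[of a] less.prems(2) by auto
      then show ?thesis using step[of "Q a"] 1 Q_refl Q_eq by simp
    next
      case 2
      show ?thesis
      proof (cases "Q a \<union> Q c = S")
        case True
        have "Q a \<inter> Q c = {}" using 2(2) Q_eq Q_refl by (metis disjoint_iff)
        moreover have "Q a \<noteq> {}" "Q c \<noteq> {}" using Q_refl by blast+
        ultimately have "splits R (Q a) (Q c)"
          unfolding splits_def True unfolding Q_def[symmetric] using Q_eq by simp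
        then have "good S" unfolding good_def using True 2 Q_refl by (intro exI[of _ "Q a"] exI[of _ "Q c"]) simp
        then show ?thesis ..
      next
        case False
        then have "Q a \<union> Q c \<subset> S" using Q_S[of a] Q_S[of c] less.prems(2) by auto
        moreover have "Q x \<subseteq> Q a \<union> Q c" if "x \<in> Q a \<union> Q c" for x using that Q_eq[of x] by auto
        moreover have "{a, b, c} \<subseteq> Q a \<union> Q c" using 2 Q_refl by simp
        ultimately show ?thesis by (rule step)
      qed
    next
      case 3
      \<comment> \<open>This is \<open>glue\<close> with nothing in K: every cluster lies within a
        single component, so none contains both a and b.\<close>
      define G where "G = insert {} {} \<union> {C \<inter> Q x | C x. C \<in> insert UNIV F \<and> x \<in> S - {}}"
      have emp: "laminar {}" "R \<inter> cluster_triples {} UNIV \<subseteq> cluster_triples {} {}"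
        by (auto simp: laminar_def cluster_triples_def)
      have "laminar G" "G \<subseteq> Pow S" "R \<inter> cluster_triples S UNIV \<subseteq> cluster_triples S G"
        unfolding G_def Q_def
        by (rule glue[OF lam R_F empty_subsetI _ emp(1) empty_subsetI emp(2)]; simp)+
      moreover have "\<not> (a \<in> C \<and> b \<in> C \<and> c \<notin> C)" if C_G: "C \<in> G" for C
      proof
        assume C: "a \<in> C \<and> b \<in> C \<and> c \<notin> C"
        then obtain x where "a \<in> Q x" "b \<in> Q x" using C_G C unfolding G_def by auto
        then show False using 3 Q_eq[of a x] by simp
      qed
      ultimately have "avoids S G" unfolding avoids_def using not_displayed by simp
      then show ?thesis by (intro disjI2 exI)
    qed
  qed
  then show ?thesis unfolding good_def avoids_def .
qed

section \<open>The closure and the maximal splits\<close>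

lemma splits_pair:
  assumes "{A', B'} = {A, B}" "splits R A B"
  shows "A' \<union> B' = A \<union> B" "splits R A' B'"
proof -
  have "A' = A \<and> B' = B \<or> A' = B \<and> B' = A" using assms(1) by (simp only: doubleton_eq_iff)
  then have "A' \<union> B' = A \<union> B \<and> splits R A' B'"
  proof
    assume "A' = A \<and> B' = B"
    then show ?thesis using assms(2) by metis
  next
    assume "A' = B \<and> B' = A"
    then show ?thesis using assms(2) splits_commute Un_commute by metis
  qed
  then show "A' \<union> B' = A \<union> B" "splits R A' B'" by auto
qed

lemma LsetsD:
  assumes "{A, B} \<in> Lsets t R"
  shows "A \<union> B \<subseteq> leaf_set R" "splits R A B"
proof -
  obtain A' B' where *: "{A, B} = {A', B'}" "A' \<union> B' \<subseteq> leaf_set R" "splits R A' B'"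
    using assms unfolding Lsets_iff by (elim exE conjE)
  show "A \<union> B \<subseteq> leaf_set R" "splits R A B" using splits_pair[OF *(1,3)] *(2) by simp_all
qed

lemma LsetsI:
  "A \<union> B \<subseteq> leaf_set R \<Longrightarrow> splits R A B \<Longrightarrow> fst t \<subseteq> A \<Longrightarrow> snd t \<in> B \<Longrightarrow> {A, B} \<in> Lsets t R"
  unfolding Lsets_iff by (rule exI[of _ A], rule exI[of _ B]) simp

lemma triples_betweenE:
  assumes "t \<in> triples_between A B"
  obtains a b c A' B' where "t = triple a b c" "distinct [a, b, c]" "{A', B'} = {A, B}"
    "a \<in> A'" "b \<in> A'" "c \<in> B'"
  using assms unfolding triples_between_def by blast

lemma triples_betweenI:
  "distinct [a, b, c] \<Longrightarrow> a \<in> A \<Longrightarrow> b \<in> A \<Longrightarrow> c \<in> B \<Longrightarrow> triple a b c \<in> triples_between A B"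
  unfolding triples_between_def mem_Collect_eq by (intro exI[of _ a] exI[of _ b] exI[of _ c]) simp

context
  fixes R :: "'a triple set"
  assumes R: "triple_set R" "consistent R"
begin

lemma finite_leaves: "finite (leaf_set R)"
  using R finite_leaf_set consistent_finite by blast

lemma cl_iff:
  "t \<in> cl R \<longleftrightarrow> (\<forall>F. laminar F \<longrightarrow> R \<subseteq> cluster_triples (leaf_set R) F \<longrightarrow> t \<in> cluster_triples (leaf_set R) F)"
proof
  assume t: "t \<in> cl R"
  show "\<forall>F. laminar F \<longrightarrow> R \<subseteq> cluster_triples (leaf_set R) F \<longrightarrow> t \<in> cluster_triples (leaf_set R) F"
  proof (intro allI impI)
    fix F assume F: "laminar F" "R \<subseteq> cluster_triples (leaf_set R) F"
    obtain G where G: "laminar G" "G \<subseteq> Pow (leaf_set R)"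
      and eq: "cluster_triples (leaf_set R) G = cluster_triples (leaf_set R) F"
      using laminar_restrict[OF F(1)] .
    have "R \<subseteq> cluster_triples (leaf_set R) G" using F(2) eq by simp
    then have "t \<in> cluster_triples (leaf_set R) G"
      using t G unfolding cl_eq_laminar[OF R(1) consistent_finite[OF R(2)]] by simp
    then show "t \<in> cluster_triples (leaf_set R) F" using eq by simp
  qed
qed (simp add: cl_eq_laminar[OF R(1) consistent_finite[OF R(2)]])

lemma is_triple_cl:
  assumes "t \<in> cl R"
  obtains a b c where "t = triple a b c" "distinct [a, b, c]" "{a, b, c} \<subseteq> leaf_set R"
proof -
  obtain F where F: "laminar F" "R \<subseteq> cluster_triples (leaf_set R) F"
    using consistentE[OF R(2)] .
  then have "t \<in> cluster_triples (leaf_set R) F" using assms cl_iff by simp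
  then show ?thesis using that by (rule cluster_triplesE)
qed

lemma Lsets_imp_cl:
  assumes "{A, B} \<in> Lsets t R" "t' \<in> triples_between A B"
  shows "t' \<in> cl R"
proof -
  obtain a b c A' B' where t': "t' = triple a b c" "distinct [a, b, c]" "{A', B'} = {A, B}"
    "a \<in> A'" "b \<in> A'" "c \<in> B'" using assms(2) by (rule triples_betweenE)
  have AB: "A' \<union> B' \<subseteq> leaf_set R" "splits R A' B'"
    using LsetsD[OF assms(1)] splits_pair[OF t'(3)] by simp_all
  have fin: "finite (A' \<union> B')" using AB(1) finite_leaves by (rule finite_subset)
  have ne: "a \<noteq> b" using t'(2) by simp
  have "triple a b c \<in> cluster_triples (leaf_set R) F"
    if "laminar F" "R \<subseteq> cluster_triples (leaf_set R) F" for F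
    using splits_displayed[OF that fin AB(2) t'(4,5) ne t'(6)] t'(2,4-6) AB(1)
    unfolding triple_in_cluster_triples by auto
  then show ?thesis unfolding t'(1) cl_iff by simp
qed

lemma Lsets_nonempty:
  assumes "t \<in> cl R"
  shows "Lsets t R \<noteq> {}"
proof -
  obtain a b c where t: "t = triple a b c" "distinct [a, b, c]" "{a, b, c} \<subseteq> leaf_set R"
    using is_triple_cl[OF assms] .
  obtain F where F: "laminar F" "R \<subseteq> cluster_triples (leaf_set R) F"
    using consistentE[OF R(2)] .
  \<comment> \<open>On the full leaf set the restriction of R is R itself, so the second alternative
    of the dichotomy contradicts membership in the closure.\<close>
  have "cluster_triples (leaf_set R) F \<subseteq> cluster_triples (leaf_set R) UNIV"
    unfolding cluster_triples_def by blast
  then have "R \<inter> cluster_triples (leaf_set R) UNIV = R" using F(2) by blast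
  then have "\<nexists>F'. laminar F' \<and> F' \<subseteq> Pow (leaf_set R) \<and>
      R \<inter> cluster_triples (leaf_set R) UNIV \<subseteq> cluster_triples (leaf_set R) F' \<and>
      triple a b c \<notin> cluster_triples (leaf_set R) F'"
    using assms unfolding cl_iff t(1) by simp
  then obtain A B where "A \<union> B \<subseteq> leaf_set R" "splits R A B" "a \<in> A" "b \<in> A" "c \<in> B"
    using exists_splits_or_avoiding[OF F finite_leaves t(2,3)] by (elim disjE exE conjE) simp_all
  then have "{A, B} \<in> Lsets t R" unfolding t(1) by (intro LsetsI) simp_all
  then show ?thesis by (rule ex_in_conv[THEN iffD1, OF exI])
qed

lemma Lsets_join:
  assumes "{A, B} \<in> Lsets t R" "fst t \<subseteq> A" "snd t \<in> B" "{A', B'} \<in> Lsets t R" "fst t \<subseteq> A'" "snd t \<in> B'"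
    "fst t \<noteq> {}"
  shows "{A \<union> A', B \<union> B'} \<in> Lsets t R"
proof -
  obtain F where F: "laminar F" "R \<subseteq> cluster_triples (leaf_set R) F"
    using consistentE[OF R(2)] .
  note * = LsetsD[OF assms(1)] LsetsD[OF assms(4)]
  have "A \<inter> A' \<noteq> {}" "B \<inter> B' \<noteq> {}" using assms by blast+
  then have "splits R (A \<union> A') (B \<union> B')"
    using splits_join[OF F finite_subset[OF *(1) finite_leaves] finite_subset[OF *(3) finite_leaves] *(2,4)]
    by simp
  moreover have "(A \<union> A') \<union> (B \<union> B') \<subseteq> leaf_set R" using *(1,3) by auto
  ultimately show ?thesis using assms(2,3) by (intro LsetsI) auto
qed

text \<open>Joining a pair of maximal size with any other pair, both oriented by t, cannot enlarge
  its union. Since the sides of the join are disjoint, this forces inclusion side by side. Greatest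
  in this sense implies that the maximizer is unique, which the description operator in
  \<open>Lstar\<close> requires.\<close>

lemma Lstar_is_greatest:
  assumes "t \<in> cl R"
  obtains A B where "Lstar t R = {A, B}" "{A, B} \<in> Lsets t R" "fst t \<subseteq> A" "snd t \<in> B" "splits R A B"
    "\<forall>A' B'. {A', B'} \<in> Lsets t R \<longrightarrow> fst t \<subseteq> A' \<longrightarrow> snd t \<in> B' \<longrightarrow> A' \<subseteq> A \<and> B' \<subseteq> B"
proof -
  let ?f = "\<lambda>P. card (\<Union>P :: 'a set)"
  obtain a b c where "t = triple a b c" using is_triple_cl[OF assms] .
  then have ne: "fst t \<noteq> {}" by simp
  have "Lsets t R \<subseteq> Pow (Pow (leaf_set R))"
  proof
    fix P assume "P \<in> Lsets t R"
    then obtain A B where "P = {A, B}" "A \<union> B \<subseteq> leaf_set R" unfolding Lsets_iff by (elim exE conjE)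
    then show "P \<in> Pow (Pow (leaf_set R))" by simp
  qed
  then have fin: "finite (Lsets t R)" using finite_leaves by (simp add: finite_subset)
  obtain P where P: "P \<in> Lsets t R" and P_Max: "?f P = Max (?f ` Lsets t R)"
    using obtains_MAX[OF fin Lsets_nonempty[OF assms], of ?f] by metis
  have P_max: "?f P' \<le> ?f P" if "P' \<in> Lsets t R" for P'
    unfolding P_Max using fin that by simp
  from P obtain A B where AB: "P = {A, B}" "A \<union> B \<subseteq> leaf_set R" "splits R A B" "fst t \<subseteq> A" "snd t \<in> B"
    unfolding Lsets_iff by (elim exE conjE)
  have greatest: "A' \<subseteq> A \<and> B' \<subseteq> B" if "{A', B'} \<in> Lsets t R" "fst t \<subseteq> A'" "snd t \<in> B'" for A' B'
  proof -
    have join: "{A \<union> A', B \<union> B'} \<in> Lsets t R"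
      using Lsets_join[OF P[unfolded AB(1)] AB(4,5) that ne] .
    note sp = LsetsD(2)[OF join] LsetsD(1)[OF join]
    have "card ((A \<union> A') \<union> (B \<union> B')) \<le> card (A \<union> B)" using P_max[OF join] AB(1) by simp
    moreover have "A \<union> B \<subseteq> (A \<union> A') \<union> (B \<union> B')" by auto
    moreover have "finite ((A \<union> A') \<union> (B \<union> B'))" using sp(2) finite_leaves by (rule finite_subset)
    ultimately have eq: "A \<union> B = (A \<union> A') \<union> (B \<union> B')" by (intro card_seteq)
    have disj: "(A \<union> A') \<inter> (B \<union> B') = {}" using sp(1) by (rule splits_disjoint)
    show ?thesis using eq disj by blast
  qed
  have "Lstar t R = P"
    unfolding Lstar_def
  proof (rule the_equality)
    show "is_arg_max ?f (\<lambda>P. P \<in> Lsets t R) P"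
      unfolding is_arg_max_linorder using P P_max by simp
  next
    fix P' assume "is_arg_max ?f (\<lambda>P. P \<in> Lsets t R) P'"
    then have P': "P' \<in> Lsets t R" "?f P \<le> ?f P'"
      unfolding is_arg_max_linorder using P by simp_all
    from P'(1) obtain A' B' where AB': "P' = {A', B'}" "fst t \<subseteq> A'" "snd t \<in> B'"
      unfolding Lsets_iff by (elim exE conjE)
    have sub: "A' \<subseteq> A" "B' \<subseteq> B" using greatest[OF P'(1)[unfolded AB'(1)] AB'(2,3)] by simp_all
    have "card (A \<union> B) \<le> card (A' \<union> B')" using P'(2) AB(1) AB'(1) by simp
    then have "A' \<union> B' = A \<union> B"
      using sub by (intro card_seteq finite_subset[OF AB(2) finite_leaves] Un_mono)
    moreover have "A \<inter> B = {}" using AB(3) by (rule splits_disjoint)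
    ultimately have "A' = A" "B' = B" using sub by auto
    then show "P' = P" using AB(1) AB'(1) by simp
  qed
  then have "Lstar t R = {A, B}" using AB(1) by simp
  then show ?thesis
    by (rule that[OF _ P[unfolded AB(1)] AB(4,5,3)]) (intro allI impI greatest)
qed

section \<open>The closure as a disjoint union\<close>

lemma R_subset_cl: "R \<subseteq> cl R"
  by (auto simp: cl_iff)

text \<open>The greatest pair of t' contains that of t, so it separates t as well and is contained
  in the greatest pair of t. The two triples may use the sides in opposite roles, whence the two
  cases.\<close>

lemma Lstar_triples_between:
  assumes "t \<in> cl R" "Lstar t R = {A, B}" "t' \<in> triples_between A B"
  shows "Lstar t' R = {A, B}"
proof -
  obtain A0 B0 where t: "Lstar t R = {A0, B0}" "{A0, B0} \<in> Lsets t R" "fst t \<subseteq> A0" "snd t \<in> B0"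
    "splits R A0 B0"
    "\<forall>A' B'. {A', B'} \<in> Lsets t R \<longrightarrow> fst t \<subseteq> A' \<longrightarrow> snd t \<in> B' \<longrightarrow> A' \<subseteq> A0 \<and> B' \<subseteq> B0"
    by (rule Lstar_is_greatest[OF assms(1)])
  obtain a b c A1 B1 where t': "t' = triple a b c" "distinct [a, b, c]" "{A1, B1} = {A, B}"
    "a \<in> A1" "b \<in> A1" "c \<in> B1" using assms(3) by (rule triples_betweenE)
  have eq: "{A1, B1} = {A0, B0}" using t'(3) t(1) assms(2) by simp
  have AB1: "A1 \<union> B1 \<subseteq> leaf_set R" "splits R A1 B1"
    using splits_pair[OF eq t(5)] LsetsD(1)[OF t(2)] by simp_all
  have L1: "{A1, B1} \<in> Lsets t' R" using AB1 t'(4-6) unfolding t'(1) by (intro LsetsI) simp_all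
  have "t' \<in> triples_between A1 B1"
    using t'(2,4-6) unfolding t'(1) by (intro triples_betweenI)
  then have "t' \<in> cl R" using Lsets_imp_cl[OF L1] by simp
  then obtain A2 B2 where t2: "Lstar t' R = {A2, B2}" "{A2, B2} \<in> Lsets t' R" "splits R A2 B2"
    "\<forall>A' B'. {A', B'} \<in> Lsets t' R \<longrightarrow> fst t' \<subseteq> A' \<longrightarrow> snd t' \<in> B' \<longrightarrow> A' \<subseteq> A2 \<and> B' \<subseteq> B2"
    by (rule Lstar_is_greatest)
  have sub: "A1 \<subseteq> A2" "B1 \<subseteq> B2" using t2(4)[rule_format, OF L1] t'(4-6) unfolding t'(1) by simp_all
  note AB2 = LsetsD(1)[OF t2(2)]
  consider "A1 = A0" "B1 = B0" | "A1 = B0" "B1 = A0" using eq by (auto simp: doubleton_eq_iff)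
  then have "A2 = A1 \<and> B2 = B1"
  proof cases
    case 1
    then have "fst t \<subseteq> A2" "snd t \<in> B2" using t(3,4) sub by auto
    then show ?thesis using t(6)[rule_format, OF LsetsI[OF AB2 t2(3)]] sub 1 by simp
  next
    case 2
    then have "fst t \<subseteq> B2" "snd t \<in> A2" using t(3,4) sub by auto
    moreover have "B2 \<union> A2 \<subseteq> leaf_set R" "splits R B2 A2"
      using AB2 t2(3) splits_commute by auto
    ultimately show ?thesis using t(6)[rule_format, OF LsetsI, of B2 A2] sub 2 by simp
  qed
  then show ?thesis using t2(1) t'(3) by simp
qed

text \<open>If all edges of \<open>A\<close> were witnessed by a third leaf in \<open>A\<close>, then the Ahograph on \<open>A\<close> alone would
  be connected.\<close>

lemma splits_crossing_triple:
  assumes "splits R A B" "A \<union> B \<subseteq> leaf_set R" "a \<in> A" "b \<in> A" "a \<noteq> b"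
  shows "R \<inter> triples_between A B \<noteq> {}"
proof
  assume none: "R \<inter> triples_between A B = {}"
  obtain F where F: "laminar F" "R \<subseteq> cluster_triples (leaf_set R) F"
    using consistentE[OF R(2)] .
  have A: "(a, y) \<in> (aho R (A \<union> B))\<^sup>* \<longleftrightarrow> y \<in> A" for y
    using splitsD1[OF assms(1,3)] by (simp flip: aho_class_iff)
  have conn: "(a, y) \<in> (aho R A)\<^sup>*" if "(a, y) \<in> (aho R (A \<union> B))\<^sup>*" for y
    using that
  proof (induction rule: rtrancl_induct)
    case (step y z)
    obtain w where w: "w \<in> A \<union> B" "triple y z w \<in> R" using step.hyps(2) by (auto simp: aho_iff)
    have yz: "y \<in> A" "z \<in> A" "y \<noteq> z"
      using A[of y] A[of z] step.hyps rtrancl_into_rtrancl[OF step.hyps] by (simp_all add: aho_iff)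
    have "distinct [y, z, w]" using subsetD[OF F(2) w(2)] unfolding triple_in_cluster_triples by simp
    \<comment> \<open>Otherwise yz|w would be a triple of R across A and B; so the edge yz survives
      in the graph on A.\<close>
    then have "w \<notin> B" using triples_betweenI[of y z w A B] none w(2) yz by auto
    then have "(y, z) \<in> aho R A" using w yz by (auto simp: aho_iff)
    then show ?case using step.IH by simp
  qed simp
  have "finite A" using assms(2) finite_leaves finite_subset by blast
  then obtain z where "z \<in> A" "(a, z) \<notin> (aho R A)\<^sup>*"
    using aho_disconnected[OF F, of A a b] assms by blast
  then show False using conn A by blast
qed

text \<open>A triple t lies across its own greatest pair. A triple of R across the same pair exists
  by \<open>splits_crossing_triple\<close> and has the same greatest pair, so t is already covered
  from R.\<close>

lemma cl_eq_Union: "cl R = (\<Union>P\<in>Lstar_set R R. triples_of_pair P)"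
proof (intro equalityI subsetI)
  fix t assume t: "t \<in> cl R"
  obtain A B where AB: "Lstar t R = {A, B}" "{A, B} \<in> Lsets t R" "fst t \<subseteq> A" "snd t \<in> B" "splits R A B"
    using Lstar_is_greatest[OF t] .
  obtain a b c where abc: "t = triple a b c" "distinct [a, b, c]" using is_triple_cl[OF t] .
  have in_AB: "a \<in> A" "b \<in> A" "c \<in> B" "a \<noteq> b" using AB(3,4) abc(2) unfolding abc(1) by simp_all
  then have "R \<inter> triples_between A B \<noteq> {}"
    using splits_crossing_triple[OF AB(5) LsetsD(1)[OF AB(2)]] by simp
  then obtain r where "r \<in> R" "r \<in> triples_between A B" by (metis disjoint_iff)
  then have "{A, B} \<in> Lstar_set R R"
    using Lstar_triples_between[OF t AB(1)] unfolding Lstar_set_def by (metis imageI)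
  moreover have "t \<in> triples_of_pair {A, B}"
    unfolding triples_of_pair_eq abc(1) using abc(2) in_AB(1-3) by (rule triples_betweenI)
  ultimately show "t \<in> (\<Union>P\<in>Lstar_set R R. triples_of_pair P)" by blast
next
  fix t assume "t \<in> (\<Union>P\<in>Lstar_set R R. triples_of_pair P)"
  then obtain r where r: "r \<in> R" "t \<in> triples_of_pair (Lstar r R)" unfolding Lstar_set_def by auto
  obtain A B where AB: "Lstar r R = {A, B}" "{A, B} \<in> Lsets r R"
    using Lstar_is_greatest[OF subsetD[OF R_subset_cl r(1)]] .
  then have "t \<in> triples_between A B" using r(2) by (simp only: triples_of_pair_eq)
  then show "t \<in> cl R" by (rule Lsets_imp_cl[OF AB(2)])
qed

text \<open>A pair can be recovered from any triple across it, so two pairs with a common triple are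
  equal.\<close>

lemma Lstar_setE:
  assumes "P \<in> Lstar_set R R"
  obtains A B where "P = {A, B}" "\<forall>t\<in>triples_between A B. Lstar t R = P"
proof -
  obtain r where r: "r \<in> cl R" "P = Lstar r R" using assms R_subset_cl unfolding Lstar_set_def by blast
  obtain A B where AB: "Lstar r R = {A, B}" using Lstar_is_greatest[OF r(1)] .
  then have P: "P = {A, B}" using r(2) by simp
  have "\<forall>t\<in>triples_between A B. Lstar t R = P"
    using Lstar_triples_between[OF r(1) AB] P by simp
  with P show ?thesis by (rule that)
qed

lemma triples_of_pair_disjoint:
  assumes "P \<in> Lstar_set R R" "P' \<in> Lstar_set R R" "P \<noteq> P'"
  shows "triples_of_pair P \<inter> triples_of_pair P' = {}"
proof -
  obtain A B where P: "P = {A, B}" "\<forall>t\<in>triples_between A B. Lstar t R = P"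
    using assms(1) by (rule Lstar_setE)
  obtain A' B' where P': "P' = {A', B'}" "\<forall>t\<in>triples_between A' B'. Lstar t R = P'"
    using assms(2) by (rule Lstar_setE)
  have False if "t \<in> triples_of_pair P" "t \<in> triples_of_pair P'" for t
    using P(2) P'(2) that assms(3) unfolding P(1) P'(1) triples_of_pair_eq by metis
  then show ?thesis by blast
qed

text \<open>By disjointness the sum is the size of the closure, and the closure is covered by the
  images of the ordered triples of leaves.\<close>

lemma sum_card_triples_of_pair:
  "(\<Sum>P\<in>Lstar_set R R. card (triples_of_pair P)) \<le> card (leaf_set R) ^ 3"
proof -
  let ?X = "leaf_set R"
  let ?t = "\<lambda>(a, b, c). triple a b c"
  have sub: "cl R \<subseteq> ?t ` (?X \<times> ?X \<times> ?X)"
  proof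
    fix t assume "t \<in> cl R"
    then obtain a b c where "t = triple a b c" "{a, b, c} \<subseteq> ?X" by (rule is_triple_cl)
    then show "t \<in> ?t ` (?X \<times> ?X \<times> ?X)" by (intro image_eqI[of _ _ "(a, b, c)"]) auto
  qed
  have fin: "finite (?X \<times> ?X \<times> ?X)" using finite_leaves by blast
  then have finc: "finite (cl R)" using sub finite_subset by blast
  have "(\<Sum>P\<in>Lstar_set R R. card (triples_of_pair P)) = card (\<Union>P\<in>Lstar_set R R. triples_of_pair P)"
  proof (rule card_UN_disjoint[symmetric])
    show "finite (Lstar_set R R)" using consistent_finite[OF R(2)] by (simp add: Lstar_set_def)
    show "\<forall>P\<in>Lstar_set R R. finite (triples_of_pair P)"
      using finc cl_eq_Union by (metis UN_upper finite_subset)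
  qed (use triples_of_pair_disjoint in blast)
  also have "\<dots> = card (cl R)" by (simp add: cl_eq_Union)
  also have "\<dots> \<le> card (?X \<times> ?X \<times> ?X)" using sub fin by (rule surj_card_le[rotated])
  also have "\<dots> = card ?X ^ 3" by (simp add: card_cartesian_product power3_eq_cube)
  finally show ?thesis .
qed

end

theorem mainTheorem5:
  fixes R :: "'a triple set"
  assumes "triple_set R" and "consistent R"
  shows "cl R = (\<Union>{triples_between A B | A B. {A, B} \<in> Lstar_set R R})
    \<and> (\<forall>A B A' B'. {A, B} \<in> Lstar_set R R \<and> {A', B'} \<in> Lstar_set R R \<and> {A, B} \<noteq> {A', B'}
          \<longrightarrow> triples_between A B \<inter> triples_between A' B' = {})
    \<and> (\<Sum>P\<in>Lstar_set R R. card (triples_of_pair P)) \<le> card (leaf_set R) ^ 3"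
proof (intro conjI allI impI)
  have "(\<Union>P\<in>Lstar_set R R. triples_of_pair P) = \<Union>{triples_between A B | A B. {A, B} \<in> Lstar_set R R}"
  proof (intro equalityI subsetI)
    fix t assume "t \<in> (\<Union>P\<in>Lstar_set R R. triples_of_pair P)"
    then obtain P where P: "P \<in> Lstar_set R R" "t \<in> triples_of_pair P" by blast
    obtain A B where AB: "P = {A, B}" using Lstar_setE[OF assms P(1)] .
    then have "{A, B} \<in> Lstar_set R R" "t \<in> triples_between A B"
      using P by (simp_all only: triples_of_pair_eq)
    then show "t \<in> \<Union>{triples_between A B | A B. {A, B} \<in> Lstar_set R R}"
      by (intro UnionI[of "triples_between A B"] CollectI exI[of _ A] exI[of _ B]) simp_all
  next
    fix t assume "t \<in> \<Union>{triples_between A B | A B. {A, B} \<in> Lstar_set R R}"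
    then obtain A B where AB: "{A, B} \<in> Lstar_set R R" "t \<in> triples_between A B"
      by (elim UnionE CollectE exE conjE) simp
    then show "t \<in> (\<Union>P\<in>Lstar_set R R. triples_of_pair P)"
      by (intro UN_I[OF AB(1)]) (simp only: triples_of_pair_eq)
  qed
  then show "cl R = \<Union>{triples_between A B | A B. {A, B} \<in> Lstar_set R R}"
    by (simp add: cl_eq_Union[OF assms])
next
  fix A B A' B'
  assume "{A, B} \<in> Lstar_set R R \<and> {A', B'} \<in> Lstar_set R R \<and> {A, B} \<noteq> {A', B'}"
  then show "triples_between A B \<inter> triples_between A' B' = {}"
    using triples_of_pair_disjoint[OF assms, of "{A, B}" "{A', B'}"]
    by (simp only: triples_of_pair_eq simp_thms)
qed (rule sum_card_triples_of_pair[OF assms])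

end
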